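(* Let $d>1$ be an integer and let $m,t$ be positive integers such that $t$ divides $m$, and let $\theta:\mathbb{D}^d\to\theta(\mathbb{D}^d)$ be the basic polynomial map associated to the group $G(m,t,d)$. Any holomorphic function $f:\theta(\mathbb{D}^d)\to\overline{\mathbb{D}}$ can be approximated, uniformly on compact subsets of $\theta(\mathbb{D}^d)$, by rational inner functions belonging to $\mathcal{A}(\theta(\mathbb{D}^d))$.
   Context: $\mathbb{D}$ is the open unit disc, $\mathbb{T}$ the unit circle. The map $\theta=(\theta_1,\dots,\theta_d)$ is given by $\theta_j(\boldsymbol z)=E_j(z_1^m,\dots,z_d^m)$ for $1\le j\le d-1$ and $\theta_d(\boldsymbol z)=(z_1\cdots z_d)^{m/t}$, where $E_j$ is the $j$-th elementary symmetric polynomial in $d$ variables. ($G(m,t,d)$ is the group of maps $\boldsymbol z\mapsto(\alpha^{\nu_1}z_{\sigma(1)},\dots,\alpha^{\nu_d}z_{\sigma(d)})$ with $\alpha=e^{2\pi i/m}$, $\sigma\in S_d$ and integers $\nu_1,\dots,\nu_d$ whose sum is divisible by $t$; $\theta(\mathbb{D}^d)$ is a domain in $\mathbb{C}^d$ biholomorphic to $\mathbb{D}^d/G(m,t,d)$.) $H^\infty(\theta(\mathbb{D}^d))$ is the Banach algebra of bounded holomorphic functions on $\theta(\mathbb{D}^d)$ with the sup norm, and $\mathcal{A}(\theta(\mathbb{D}^d))$ is the algebra of continuous functions on $\overline{\theta(\mathbb{D}^d)}$ that are holomorphic in $\theta(\mathbb{D}^d)$. Write $\partial\theta(\mathbb{D}^d)=\theta(\mathbb{T}^d)$,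 and let $\mu$ be the push-forward under $\theta$ of the normalized Haar measure $\nu$ on $\mathbb{T}^d$. Each $f\in H^\infty(\theta(\mathbb{D}^d))$ has a boundary function $f^*(\boldsymbol q)=\lim_{r\to1^-}f(r^mq_1,r^{2m}q_2,\dots,r^{(d-1)m}q_{d-1},r^{dm/t}q_d)$, defined for $\mu$-almost every $\boldsymbol q\in\partial\theta(\mathbb{D}^d)$. A function $f\in H^\infty(\theta(\mathbb{D}^d))$ is called inner if $|f^*|=1$ $\mu$-almost everywhere on $\partial\theta(\mathbb{D}^d)$; a rational inner function is a rational function with poles off $\theta(\mathbb{D}^d)$ which is also inner. *)

theory Defs
  imports "HOL-Probability.Probability"
begin

type_synonym 'd cvec = "(complex, 'd) vec"

text \<open>The dimension is \<open>d = CARD('d)\<close>. The linear order on the index type numbers the coordinates: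
  the coordinate \<open>z $ i\<close> is the one written \<open>z\<^sub>j\<close> with \<open>j = pos i\<close>, so that \<open>pos\<close> is a bijection
  onto \<open>{1..d}\<close>.\<close>

definition pos :: "'d::{finite,linorder} \<Rightarrow> nat" where
  "pos i = card {..i}"

definition polydisc :: "'d::finite cvec set" where
  "polydisc = {z. \<forall>i. norm (z $ i) < 1}"

definition torus :: "'d::finite cvec set" where
  "torus = {z. \<forall>i. norm (z $ i) = 1}"

definition elem_sym :: "nat \<Rightarrow> 'd::finite cvec \<Rightarrow> complex" where
  "elem_sym j w = (\<Sum>S | card S = j. \<Prod>i\<in>S. w $ i)"

definition theta :: "nat \<Rightarrow> nat \<Rightarrow> 'd::{finite,linorder} cvec \<Rightarrow> 'd cvec" where
  "theta m t z =
     (\<chi> i. if pos i < CARD('d) then elem_sym (pos i) (\<chi> k. (z $ k) ^ m)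
           else (\<Prod>k\<in>UNIV. z $ k) ^ (m div t))"

definition theta_dom :: "nat \<Rightarrow> nat \<Rightarrow> 'd::{finite,linorder} cvec set" where
  "theta_dom m t = theta m t ` polydisc"

definition theta_bdry :: "nat \<Rightarrow> nat \<Rightarrow> 'd::{finite,linorder} cvec set" where
  "theta_bdry m t = theta m t ` torus"

text \<open>Holomorphy in several variables, meant for open \<open>S\<close>: the real Frechet derivative exists
  and is complex linear at every point of \<open>S\<close>.\<close>

definition holomorphic_on_vec :: "('d::finite cvec \<Rightarrow> complex) \<Rightarrow> 'd cvec set \<Rightarrow> bool" where
  "holomorphic_on_vec f S \<longleftrightarrow>
     (\<forall>z\<in>S. \<exists>D. (f has_derivative D) (at z) \<and> (\<forall>c v. D (c *s v) = c * D v))"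

text \<open>Functions are total; only their values on \<open>theta_dom m t\<close> (respectively on its closure)
  matter for the following two algebras.\<close>

definition H_infty :: "nat \<Rightarrow> nat \<Rightarrow> ('d::{finite,linorder} cvec \<Rightarrow> complex) set" where
  "H_infty m t = {f. holomorphic_on_vec f (theta_dom m t) \<and> bounded (f ` theta_dom m t)}"

definition A_algebra :: "nat \<Rightarrow> nat \<Rightarrow> ('d::{finite,linorder} cvec \<Rightarrow> complex) set" where
  "A_algebra m t =
     {f. continuous_on (closure (theta_dom m t)) f \<and> holomorphic_on_vec f (theta_dom m t)}"

text \<open>Normalized Haar measure on the torus: the image of Lebesgue measure on the unit cube under
  \<open>x \<mapsto> (exp (2 \<pi> i x\<^sub>1), \<dots>, exp (2 \<pi> i x\<^sub>d))\<close>.\<close>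

definition haar_torus :: "'d::finite cvec measure" where
  "haar_torus =
     distr (uniform_measure lborel (cbox 0 1 :: (real ^ 'd) set)) (restrict_space borel torus)
       (\<lambda>x. \<chi> i. cis (2 * pi * x $ i))"

definition bdry_measure :: "nat \<Rightarrow> nat \<Rightarrow> 'd::{finite,linorder} cvec measure" where
  "bdry_measure m t = distr haar_torus (restrict_space borel (theta_bdry m t)) (theta m t)"

definition dilate :: "nat \<Rightarrow> nat \<Rightarrow> real \<Rightarrow> 'd::{finite,linorder} cvec \<Rightarrow> 'd cvec" where
  "dilate m t r q =
     (\<chi> i. of_real (r ^ (if pos i < CARD('d) then pos i * m else CARD('d) * m div t)) * q $ i)"

definition bdry_fun ::
  "nat \<Rightarrow> nat \<Rightarrow> ('d::{finite,linorder} cvec \<Rightarrow> complex) \<Rightarrow> 'd cvec \<Rightarrow> complex" where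
  "bdry_fun m t f q = Lim (at_left 1) (\<lambda>r. f (dilate m t r q))"

text \<open>\<open>Lim\<close> is unspecified where there is no limit, so its existence is required explicitly.\<close>

definition is_inner :: "nat \<Rightarrow> nat \<Rightarrow> ('d::{finite,linorder} cvec \<Rightarrow> complex) \<Rightarrow> bool" where
  "is_inner m t f \<longleftrightarrow> f \<in> H_infty m t \<and>
     (AE q in bdry_measure m t.
        ((\<lambda>r. f (dilate m t r q)) \<longlongrightarrow> bdry_fun m t f q) (at_left 1) \<and>
        norm (bdry_fun m t f q) = 1)"

definition polynomial_fun :: "('d::finite cvec \<Rightarrow> complex) \<Rightarrow> bool" where
  "polynomial_fun p \<longleftrightarrow>
     (\<exists>(A :: ('d \<Rightarrow> nat) set) c. finite A \<and>
        (\<forall>z. p z = (\<Sum>a\<in>A. c a * (\<Prod>i\<in>UNIV. (z $ i) ^ a i))))"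

text \<open>Rational functions with poles off \<open>S\<close>. On the boundary of \<open>S\<close> the denominator may vanish.\<close>

definition rational_on :: "('d::finite cvec \<Rightarrow> complex) \<Rightarrow> 'd cvec set \<Rightarrow> bool" where
  "rational_on f S \<longleftrightarrow>
     (\<exists>p q. polynomial_fun p \<and> polynomial_fun q \<and> (\<forall>z\<in>S. q z \<noteq> 0 \<and> f z = p z / q z))"

definition rational_inner :: "nat \<Rightarrow> nat \<Rightarrow> ('d::{finite,linorder} cvec \<Rightarrow> complex) \<Rightarrow> bool" where
  "rational_inner m t f \<longleftrightarrow> rational_on f (theta_dom m t) \<and> is_inner m t f"

end

theory Submission
  imports Defs "HOL-Complex_Analysis.Complex_Analysis"
    "HOL-Computational_Algebra.Fundamental_Theorem_Algebra"
begin

text \<open>Write \<open>r\<cdot>q\<close> for the weighted dilation with \<open>\<theta> (r z) = r\<cdot>\<theta> z\<close>. The function \<open>\<lambda> \<mapsto> f (\<lambda>\<cdot>q)\<close> is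
  bounded and holomorphic on the unit disc, so interpolating it at roots of unity scaled by a small
  radius approximates \<open>f (r\<cdot>q)\<close>, uniformly in \<open>q\<close>, by combinations of the values of \<open>f\<close> near \<open>0\<close>,
  where \<open>f\<close> is a uniform limit of polynomials. This yields polynomials \<open>p\<close> with \<open>\<bar>p\<bar> \<le> c < 1\<close> that
  approximate \<open>f\<close>. On \<open>theta_bdry\<close> some \<open>Q = q\<^sub>d ^ a * cnj p\<close> is a polynomial in \<open>q\<close>, and by the maximum
  principle \<open>\<bar>Q\<bar> \<le> c\<close> on \<open>theta_dom\<close>; hence \<open>(q\<^sub>d ^ (a + n) + p) / (1 + q\<^sub>d ^ n * Q)\<close> is a rational inner
  function, continuous up to the boundary, and it tends to \<open>p\<close> locally uniformly as \<open>n\<close> grows.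
  Working with polynomials in \<open>q\<close> throughout avoids the theorem on polynomial invariants of
  \<open>G(m,t,d)\<close>.\<close>

unbundle no Formal_Power_Series.fps_syntax

section \<open>Interpolation on a circle\<close>

text \<open>The terms are the powers of an \<open>N\<close>-th root of unity other than 1, so the
  geometric sum formula applies. The index \<open>i\<close> is an integer because it will be a
  difference of two exponents.\<close>

lemma sum_cis_power_eq_0:
  fixes i :: int and N :: nat
  assumes "\<bar>i\<bar> < int N" "i \<noteq> 0"
  shows "(\<Sum>j<N. cis (2 * pi * real j * real_of_int i / real N)) = 0"
proof -
  have N: "N > 0" using assms by auto
  define c where "c = cis (2 * pi * real_of_int i / real N)"
  have "c \<noteq> 1"
  proof
    assume "c = 1"
    then have "cos (2 * pi * real_of_int i / real N) = 1"
      by (simp add: c_def complex_eq_iff)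
    then obtain k :: int where "2 * pi * real_of_int i / real N = real_of_int k * 2 * pi"
      by (auto simp: cos_one_2pi_int)
    then have "real_of_int i = real_of_int (k * int N)"
      using N by (simp add: field_simps)
    then have i: "i = k * int N" by linarith
    then have "k \<noteq> 0" using assms by auto
    then have "\<bar>k\<bar> * int N \<ge> int N" using N by auto
    then show False using assms i by (simp add: abs_mult)
  qed
  have "c ^ N = 1"
  proof -
    have "c ^ N = cis (2 * pi * real_of_int i)"
      using N by (simp add: c_def Complex.DeMoivre)
    then show ?thesis by (simp add: cis_multiple_2pi)
  qed
  have "(\<Sum>j<N. cis (2 * pi * real j * real_of_int i / real N)) = (\<Sum>j<N. c ^ j)"
    by (simp add: c_def Complex.DeMoivre mult_ac)
  also have "\<dots> = 0"
    using \<open>c \<noteq> 1\<close> \<open>c ^ N = 1\<close> by (simp add: geometric_sum)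
  finally show ?thesis .
qed

text \<open>Discrete orthogonality: averaging against \<open>inverse (w j ^ k)\<close> over the
  nodes extracts the \<open>k\<close>-th coefficient of a polynomial of degree below
  \<open>N\<close>. The radius only contributes the factor \<open>\<rho> ^ n / \<rho> ^ k\<close>,
  which is 1 when \<open>n = k\<close>.\<close>

lemma trig_interpolation_monom:
  fixes \<rho> :: real
  assumes "\<rho> > 0" "n < N" "k < N"
  defines "w \<equiv> \<lambda>j::nat. of_real \<rho> * cis (2 * pi * real j / real N)"
  shows "(\<Sum>j<N. inverse (w j ^ k) * w j ^ n) = (if n = k then of_nat N else 0)"
proof (cases "n = k")
  case True
  have "w j \<noteq> 0" for j using assms by (simp add: w_def)
  then show ?thesis using True by simp
next
  case False
  have "inverse (w j ^ k) * w j ^ n = of_real (\<rho> ^ n / \<rho> ^ k) *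
      cis (2 * pi * real j * real_of_int (int n - int k) / real N)" for j
  proof -
    define c where "c = cis (2 * pi * real j / real N)"
    have "cis (2 * pi * real j * real_of_int (int n - int k) / real N) = c ^ n * inverse (c ^ k)"
      by (simp add: c_def Complex.DeMoivre cis_mult algebra_simps diff_divide_distrib)
    moreover have "w j = of_real \<rho> * c"
      by (simp add: w_def c_def)
    ultimately show ?thesis
      by (simp add: power_mult_distrib divide_inverse mult_ac)
  qed
  then have "(\<Sum>j<N. inverse (w j ^ k) * w j ^ n) = of_real (\<rho> ^ n / \<rho> ^ k) *
      (\<Sum>j<N. cis (2 * pi * real j * real_of_int (int n - int k) / real N))"
    by (simp add: sum_distrib_left)
  also have "\<dots> = 0"
    by (subst sum_cis_power_eq_0) (use assms False in auto)
  finally show ?thesis using False by simp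
qed

text \<open>Cauchy's inequality on the circle of radius \<open>s\<close> bounds the
  \<open>k\<close>-th Taylor coefficient by \<open>1 / s ^ k\<close>, so the tail is dominated by a
  geometric series of ratio \<open>x / s\<close>. The bound depends neither on \<open>g\<close> nor
  on the position of \<open>z\<close> within radius \<open>x\<close>.\<close>

lemma norm_diff_taylor_le:
  fixes g :: "complex \<Rightarrow> complex"
  assumes "g holomorphic_on ball 0 R" "\<And>z. z \<in> ball 0 R \<Longrightarrow> norm (g z) \<le> 1"
    and s: "0 < s" "s < R" and z: "norm z \<le> x" "x < s"
  shows "norm (g z - (\<Sum>k<N. (deriv ^^ k) g 0 / fact k * z ^ k)) \<le> (x / s) ^ N / (1 - x / s)"
proof -
  define a where "a = (\<lambda>k. (deriv ^^ k) g 0 / fact k)"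
  have x0: "0 \<le> x" using z norm_ge_zero order_trans by blast
  have a: "norm (a k) \<le> 1 / s ^ k" for k
  proof -
    have "norm ((deriv ^^ k) g 0) \<le> fact k * 1 / s ^ k"
    proof (rule Cauchy_inequality)
      show "g holomorphic_on ball 0 s"
        using assms(1) by (rule holomorphic_on_subset) (use s in auto)
      show "continuous_on (cball 0 s) g"
        by (rule continuous_on_subset[OF holomorphic_on_imp_continuous_on[OF assms(1)]]) (use s in auto)
    qed (use s assms(2) in auto)
    then show ?thesis by (simp add: a_def norm_divide field_simps)
  qed
  have "(\<lambda>k. a k * z ^ k) sums g z"
    using holomorphic_power_series[OF assms(1), of z] s z by (auto simp: a_def)
  then have "(\<lambda>k. a (k + N) * z ^ (k + N)) sums (g z - (\<Sum>k<N. a k * z ^ k))"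
    by (rule sums_split_initial_segment)
  moreover have geo: "(\<lambda>k. (x / s) ^ N * (x / s) ^ k) sums ((x / s) ^ N * (1 / (1 - x / s)))"
    by (intro sums_mult geometric_sums) (use x0 s z in auto)
  moreover have "norm (a (k + N) * z ^ (k + N)) \<le> (x / s) ^ N * (x / s) ^ k" for k
  proof -
    have "norm (a (k + N) * z ^ (k + N)) \<le> 1 / s ^ (k + N) * x ^ (k + N)"
      unfolding norm_mult norm_power by (intro mult_mono a power_mono) (use s z x0 in auto)
    also have "\<dots> = (x / s) ^ N * (x / s) ^ k"
      by (simp add: power_add power_divide mult_ac)
    finally show ?thesis .
  qed
  ultimately have "norm (g z - (\<Sum>k<N. a k * z ^ k)) \<le> (x / s) ^ N * (1 / (1 - x / s))"
    using norm_suminf_le[OF _ sums_summable[OF geo], of "\<lambda>k. a (k + N) * z ^ (k + N)"]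
      sums_unique[OF geo] by (simp add: sums_iff)
  then show ?thesis by (simp add: a_def)
qed

text \<open>The values on one small circle determine \<open>g\<close> on a larger disc up to an error that is
  uniform in \<open>g\<close>: interpolation at the \<open>N\<close>-th roots of unity is exact in degree \<open>< N\<close> and
  amplifies errors by at most \<open>N (r / \<rho>) ^ N\<close>.\<close>

lemma circle_interpolation:
  fixes \<rho> r R \<epsilon> :: real
  assumes "0 < \<rho>" "\<rho> \<le> r" "r < R" "\<epsilon> > 0"
  obtains N :: nat and w :: "nat \<Rightarrow> complex" and b :: "nat \<Rightarrow> nat \<Rightarrow> complex"
  where "\<And>j. norm (w j) = \<rho>"
    and "\<And>g z. g holomorphic_on ball 0 R \<Longrightarrow> (\<And>z. z \<in> ball 0 R \<Longrightarrow> norm (g z) \<le> 1) \<Longrightarrow>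
          norm z \<le> r \<Longrightarrow> norm (g z - (\<Sum>k<N. \<Sum>j<N. b j k * g (w j) * z ^ k)) \<le> \<epsilon>"
proof -
  obtain s where s: "r < s" "s < R" using dense assms by blast
  define x where "x = r / s"
  have x: "0 < x" "x < 1" using s assms by (auto simp: x_def)
  \<comment> \<open>This is the total error found below: \<open>N x ^ N / (1 - x)\<close> from
    interpolating the Taylor remainder, and \<open>x ^ N / (1 - x)\<close> from the remainder at
    \<open>z\<close> itself.\<close>
  have "(\<lambda>N. (real N * x ^ N + x ^ N) / (1 - x)) \<longlonglongrightarrow> (0 + 0) / (1 - x)"
    using x by (intro tendsto_intros powser_times_n_limit_0) auto
  then have "\<forall>\<^sub>F N in sequentially. (real N * x ^ N + x ^ N) / (1 - x) < \<epsilon>"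
    using assms by (intro order_tendstoD) auto
  then have "\<forall>\<^sub>F N in sequentially. (real N * x ^ N + x ^ N) / (1 - x) < \<epsilon> \<and> N > 0"
    using eventually_gt_at_top[of 0] by eventually_elim auto
  then obtain N where N: "(real N * x ^ N + x ^ N) / (1 - x) < \<epsilon>" "N > 0"
    using eventually_happens trivial_limit_sequentially by blast
  define w where "w = (\<lambda>j::nat. of_real \<rho> * cis (2 * pi * real j / real N))"
  define b where "b = (\<lambda>j k. inverse (w j ^ k) / of_nat N)"
  have w: "norm (w j) = \<rho>" for j
    using assms by (simp add: w_def norm_mult)
  show ?thesis
  proof (rule that[OF w])
    fix g z
    assume g: "g holomorphic_on ball 0 R" "\<And>z. z \<in> ball 0 R \<Longrightarrow> norm (g z) \<le> 1"
      and z: "norm (z::complex) \<le> r"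
    define a where "a = (\<lambda>k. (deriv ^^ k) g 0 / fact k)"
    define T where "T = (\<lambda>z. \<Sum>k<N. a k * z ^ k)"
    \<comment> \<open>\<open>L\<close> is linear and reproduces the Taylor polynomial
      \<open>T\<close>. Hence \<open>g z - L g\<close> is the remainder \<open>g - T\<close> at
      \<open>z\<close>, minus \<open>L\<close> applied to the remainder at the nodes.\<close>
    define L where "L = (\<lambda>h. \<Sum>k<N. \<Sum>j<N. b j k * h (w j) * z ^ k)"
    have "(\<Sum>j<N. b j k * T (w j)) = a k" if "k < N" for k
    proof -
      have "(\<Sum>j<N. b j k * T (w j)) = (\<Sum>j<N. \<Sum>n<N. a n / of_nat N * (inverse (w j ^ k) * w j ^ n))"
        by (simp add: T_def b_def sum_distrib_left mult_ac)
      also have "\<dots> = (\<Sum>n<N. a n / of_nat N * (\<Sum>j<N. inverse (w j ^ k) * w j ^ n))"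
        by (subst sum.swap) (simp add: sum_distrib_left)
      also have "\<dots> = (\<Sum>n<N. a n / of_nat N * (if n = k then of_nat N else 0))"
        unfolding w_def using trig_interpolation_monom[OF \<open>0 < \<rho>\<close>] that by (intro sum.cong) auto
      also have "\<dots> = (\<Sum>n<N. if n = k then a k else 0)"
        using N by (intro sum.cong) auto
      also have "\<dots> = a k" using that by simp
      finally show ?thesis .
    qed
    then have LT: "L T = T z"
      by (simp add: L_def sum_distrib_right[symmetric]) (simp add: T_def)
    have lin: "L g - L T = L (\<lambda>v. g v - T v)"
      by (simp add: L_def sum_subtractf[symmetric] algebra_simps)
    define \<delta> where "\<delta> = (\<rho> / s) ^ N / (1 - \<rho> / s)"
    have \<delta>: "norm (g (w j) - T (w j)) \<le> \<delta>" for j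
      unfolding \<delta>_def T_def a_def
      by (rule norm_diff_taylor_le[OF g]) (use assms s w in auto)
    have "norm (L (\<lambda>v. g v - T v)) \<le> (\<Sum>k<N. \<Sum>j<N. (r / \<rho>) ^ N * \<delta> / real N)"
      unfolding L_def
    proof (intro order_trans[OF norm_sum] sum_mono)
      fix k j assume "k \<in> {..<N}" "j \<in> {..<N}"
      have "norm (b j k * (g (w j) - T (w j)) * z ^ k)
          \<le> inverse (\<rho> ^ k) / real N * \<delta> * r ^ k"
        unfolding norm_mult
        using assms z order_trans[OF norm_ge_zero \<delta>]
        by (intro mult_mono \<delta>)
          (auto simp: b_def norm_divide norm_inverse norm_power w intro: power_mono)
      also have "\<dots> = (r / \<rho>) ^ k * (\<delta> / real N)"
        by (simp add: power_divide field_simps)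
      also have "\<dots> \<le> (r / \<rho>) ^ N * (\<delta> / real N)"
        using assms \<open>k \<in> {..<N}\<close> order_trans[OF norm_ge_zero \<delta>]
        by (intro mult_right_mono power_increasing) auto
      finally show "norm (b j k * (g (w j) - T (w j)) * z ^ k) \<le> (r / \<rho>) ^ N * \<delta> / real N"
        by simp
    qed
    also have "\<dots> = real N * ((r / \<rho>) ^ N * \<delta>)"
      using N by simp
    \<comment> \<open>The powers of \<open>\<rho>\<close> cancel: amplification by
      \<open>(r / \<rho>) ^ N\<close> meets a remainder of order \<open>(\<rho> / s) ^ N\<close>.
      This is why the nodes may lie arbitrarily close to 0.\<close>
    also have "\<dots> = real N * (x ^ N / (1 - \<rho> / s))"
      using assms by (simp add: \<delta>_def x_def power_divide)
    also have "\<dots> \<le> real N * (x ^ N / (1 - x))"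
    proof -
      have "\<rho> / s \<le> x" using s assms by (simp add: x_def divide_right_mono)
      then show ?thesis using x by (intro mult_left_mono divide_left_mono) auto
    qed
    finally have 1: "norm (L (\<lambda>v. g v - T v)) \<le> real N * x ^ N / (1 - x)"
      by simp
    have 2: "norm (g z - T z) \<le> x ^ N / (1 - x)"
      unfolding x_def T_def a_def
      by (rule norm_diff_taylor_le[OF g]) (use assms s z in auto)
    have "g z - L g = (g z - T z) - L (\<lambda>v. g v - T v)"
      using lin LT by (simp add: algebra_simps)
    then have "norm (g z - L g) \<le> norm (g z - T z) + norm (L (\<lambda>v. g v - T v))"
      by (metis norm_triangle_ineq4)
    also have "\<dots> \<le> (real N * x ^ N + x ^ N) / (1 - x)"
      using 1 2 by (simp add: add_divide_distrib)
    finally show "norm (g z - (\<Sum>k<N. \<Sum>j<N. b j k * g (w j) * z ^ k)) \<le> \<epsilon>"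
      using N by (simp add: L_def)
  qed
qed

section \<open>Polynomial approximation on polydiscs\<close>

lemma polynomial_fun_const: "polynomial_fun (\<lambda>_. k)"
  unfolding polynomial_fun_def
  by (rule exI[of _ "{\<lambda>_. 0}"], rule exI[of _ "\<lambda>_. k"]) simp

lemma polynomial_fun_coord: "polynomial_fun (\<lambda>z. z $ i)"
proof -
  have "(\<Prod>j\<in>UNIV. (z $ j) ^ (if j = i then 1 else 0)) = z $ i" for z :: "'a cvec"
    by (simp add: if_distrib[of "(^) _"] prod.delta cong: if_cong)
  then show ?thesis
    unfolding polynomial_fun_def
    by (intro exI[of _ "{\<lambda>j. if j = i then 1 else 0}"] exI[of _ "\<lambda>_. 1"]) auto
qed

lemma polynomial_fun_add:
  assumes "polynomial_fun p" "polynomial_fun q"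
  shows "polynomial_fun (\<lambda>z. p z + q z)"
proof -
  obtain A c where A: "finite A" "\<And>z. p z = (\<Sum>a\<in>A. c a * (\<Prod>i\<in>UNIV. (z $ i) ^ a i))"
    using assms(1) by (auto simp: polynomial_fun_def)
  obtain B d where B: "finite B" "\<And>z. q z = (\<Sum>a\<in>B. d a * (\<Prod>i\<in>UNIV. (z $ i) ^ a i))"
    using assms(2) by (auto simp: polynomial_fun_def)
  define e where "e = (\<lambda>a. (if a \<in> A then c a else 0) + (if a \<in> B then d a else 0))"
  have "p z + q z = (\<Sum>a\<in>A \<union> B. e a * (\<Prod>i\<in>UNIV. (z $ i) ^ a i))" for z
  proof -
    have "p z = (\<Sum>a\<in>A \<union> B. (if a \<in> A then c a else 0) * (\<Prod>i\<in>UNIV. (z $ i) ^ a i))"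
      unfolding A(2) using A(1) B(1) by (intro sum.mono_neutral_cong_left) auto
    moreover have "q z = (\<Sum>a\<in>A \<union> B. (if a \<in> B then d a else 0) * (\<Prod>i\<in>UNIV. (z $ i) ^ a i))"
      unfolding B(2) using A(1) B(1) by (intro sum.mono_neutral_cong_left) auto
    ultimately show ?thesis
      by (simp add: e_def distrib_right sum.distrib)
  qed
  then show ?thesis
    unfolding polynomial_fun_def using A(1) B(1) by (intro exI[of _ "A \<union> B"] exI[of _ e]) auto
qed

lemma polynomial_fun_mult:
  fixes p q :: "'d::finite cvec \<Rightarrow> complex"
  assumes "polynomial_fun p" "polynomial_fun q"
  shows "polynomial_fun (\<lambda>z. p z * q z)"
proof -
  obtain A c where A: "finite A" "\<And>z. p z = (\<Sum>a\<in>A. c a * (\<Prod>i\<in>UNIV. (z $ i) ^ a i))"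
    using assms(1) by (auto simp: polynomial_fun_def)
  obtain B d where B: "finite B" "\<And>z. q z = (\<Sum>a\<in>B. d a * (\<Prod>i\<in>UNIV. (z $ i) ^ a i))"
    using assms(2) by (auto simp: polynomial_fun_def)
  define g :: "('d \<Rightarrow> nat) \<times> ('d \<Rightarrow> nat) \<Rightarrow> 'd \<Rightarrow> nat" where "g = (\<lambda>x i. fst x i + snd x i)"
  \<comment> \<open>Different pairs of exponents can have the same sum, so coefficients are
    collected over the fibres of \<open>g\<close>.\<close>
  define e where "e = (\<lambda>y. \<Sum>x\<in>{x \<in> A \<times> B. g x = y}. c (fst x) * d (snd x))"
  have "p z * q z = (\<Sum>y\<in>g ` (A \<times> B). e y * (\<Prod>i\<in>UNIV. (z $ i) ^ y i))" for z
  proof -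
    have "p z * q z = (\<Sum>x\<in>A \<times> B. c (fst x) * d (snd x) * (\<Prod>i\<in>UNIV. (z $ i) ^ g x i))"
      by (simp add: A(2) B(2) sum_product sum.cartesian_product g_def power_add prod.distrib
          split_beta mult_ac)
    also have "\<dots> = (\<Sum>y\<in>g ` (A \<times> B). \<Sum>x\<in>{x \<in> A \<times> B. g x = y}.
        c (fst x) * d (snd x) * (\<Prod>i\<in>UNIV. (z $ i) ^ g x i))"
      using A(1) B(1) by (intro sum.group[symmetric]) auto
    also have "\<dots> = (\<Sum>y\<in>g ` (A \<times> B). e y * (\<Prod>i\<in>UNIV. (z $ i) ^ y i))"
      unfolding e_def sum_distrib_right by (intro sum.cong) auto
    finally show ?thesis .
  qed
  then show ?thesis
    unfolding polynomial_fun_def using A(1) B(1)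
    by (intro exI[of _ "g ` (A \<times> B)"] exI[of _ e]) auto
qed

lemma polynomial_fun_power: "polynomial_fun p \<Longrightarrow> polynomial_fun (\<lambda>z. p z ^ n)"
  by (induction n) (auto intro: polynomial_fun_const polynomial_fun_mult)

text \<open>Hides exponents and coefficients: later facts on polynomials reduce to checks for the
  generators and the two ring operations.\<close>

lemma polynomial_fun_induct [consumes 1, case_names const coord add mult]:
  fixes p :: "'d::finite cvec \<Rightarrow> complex"
  assumes "polynomial_fun p"
    and const: "\<And>k. P (\<lambda>_. k)" and coord: "\<And>i. P (\<lambda>z. z $ i)"
    and add: "\<And>p q. P p \<Longrightarrow> P q \<Longrightarrow> P (\<lambda>z. p z + q z)"
    and mult: "\<And>p q. P p \<Longrightarrow> P q \<Longrightarrow> P (\<lambda>z. p z * q z)"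
  shows "P p"
proof -
  obtain A c where A: "finite A" "\<And>z. p z = (\<Sum>a\<in>A. c a * (\<Prod>i\<in>UNIV. (z $ i) ^ a i))"
    using assms(1) by (auto simp: polynomial_fun_def)
  have pow: "P (\<lambda>z. z $ i ^ n)" for i n
    by (induction n) (auto intro: const mult coord)
  have prod: "P (\<lambda>z. \<Prod>i\<in>I. (z $ i) ^ a i)" if "finite I" for I a
    using that by (induction I) (auto intro: const mult pow)
  have "P (\<lambda>z. \<Sum>a\<in>A. c a * (\<Prod>i\<in>UNIV. (z $ i) ^ a i))"
    using A(1) by (induction A) (auto intro!: const add mult[OF const] prod)
  then show ?thesis using A(2) by presburger
qed

lemma continuous_on_polynomial_fun: "polynomial_fun p \<Longrightarrow> continuous_on S p"
  by (induction rule: polynomial_fun_induct) (auto intro!: continuous_intros)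

lemma holomorphic_on_polynomial_fun:
  assumes "polynomial_fun p" "\<And>i. (\<lambda>t. u t $ i) holomorphic_on S"
  shows "(\<lambda>t. p (u t)) holomorphic_on S"
  using assms by (induction rule: polynomial_fun_induct) (auto intro!: holomorphic_intros)

lemma polynomial_fun_scale:
  assumes "polynomial_fun p"
  shows "polynomial_fun (\<lambda>z. p (\<chi> i. c i * z $ i))"
  using assms
  by (induction rule: polynomial_fun_induct)
    (auto intro: polynomial_fun_const polynomial_fun_coord polynomial_fun_add polynomial_fun_mult)

section \<open>Uniform approximation by polynomials\<close>

definition poly_approximable :: "('d::finite cvec \<Rightarrow> complex) \<Rightarrow> 'd cvec set \<Rightarrow> bool" where
  "poly_approximable h S \<longleftrightarrow>
     (\<forall>\<epsilon>>0. \<exists>p. polynomial_fun p \<and> (\<forall>z\<in>S. norm (h z - p z) \<le> \<epsilon>))"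

lemma poly_approximableD:
  assumes "poly_approximable h S" "\<epsilon> > 0"
  obtains p where "polynomial_fun p" "\<And>z. z \<in> S \<Longrightarrow> norm (h z - p z) \<le> \<epsilon>"
  using assms by (auto simp: poly_approximable_def)

lemma polynomial_fun_imp_approximable: "polynomial_fun p \<Longrightarrow> poly_approximable p S"
  unfolding poly_approximable_def by (metis diff_self less_imp_le norm_zero)

lemma poly_approximable_cong:
  "(\<And>z. z \<in> S \<Longrightarrow> h z = h' z) \<Longrightarrow> poly_approximable h S = poly_approximable h' S"
  by (simp add: poly_approximable_def)

lemma poly_approximable_limit:
  assumes "\<And>\<epsilon>. \<epsilon> > 0 \<Longrightarrow> \<exists>h'. poly_approximable h' S \<and> (\<forall>z\<in>S. norm (h z - h' z) \<le> \<epsilon>)"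
  shows "poly_approximable h S"
  unfolding poly_approximable_def
proof (intro allI impI)
  fix \<epsilon> :: real assume "\<epsilon> > 0"
  then obtain h' where h': "poly_approximable h' S" "\<And>z. z \<in> S \<Longrightarrow> norm (h z - h' z) \<le> \<epsilon> / 2"
    using assms[of "\<epsilon> / 2"] by auto
  obtain p where p: "polynomial_fun p" "\<And>z. z \<in> S \<Longrightarrow> norm (h' z - p z) \<le> \<epsilon> / 2"
    using poly_approximableD[OF h'(1)] \<open>\<epsilon> > 0\<close> by (metis half_gt_zero)
  have "norm (h z - p z) \<le> \<epsilon>" if "z \<in> S" for z
    using norm_diff_triangle_le[OF h'(2)[OF that] p(2)[OF that]] by simp
  then show "\<exists>p. polynomial_fun p \<and> (\<forall>z\<in>S. norm (h z - p z) \<le> \<epsilon>)" using p(1) by blast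
qed

lemma poly_approximable_add:
  assumes "poly_approximable h S" "poly_approximable k S"
  shows "poly_approximable (\<lambda>z. h z + k z) S"
  unfolding poly_approximable_def
proof (intro allI impI)
  fix \<epsilon> :: real assume e: "\<epsilon> > 0"
  obtain p where p: "polynomial_fun p" "\<And>z. z \<in> S \<Longrightarrow> norm (h z - p z) \<le> \<epsilon> / 2"
    using poly_approximableD[OF assms(1)] e by (metis half_gt_zero)
  obtain q where q: "polynomial_fun q" "\<And>z. z \<in> S \<Longrightarrow> norm (k z - q z) \<le> \<epsilon> / 2"
    using poly_approximableD[OF assms(2)] e by (metis half_gt_zero)
  have "norm ((h z + k z) - (p z + q z)) \<le> \<epsilon>" if "z \<in> S" for z
    using norm_diff_triangle_ineq[of "h z" "k z" "p z" "q z"] p(2)[OF that] q(2)[OF that] by simp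
  then show "\<exists>p. polynomial_fun p \<and> (\<forall>z\<in>S. norm (h z + k z - p z) \<le> \<epsilon>)"
    using polynomial_fun_add[OF p(1) q(1)] by blast
qed

lemma poly_approximable_mult:
  assumes "poly_approximable h S" "polynomial_fun q" "bounded (q ` S)"
  shows "poly_approximable (\<lambda>z. q z * h z) S"
  unfolding poly_approximable_def
proof (intro allI impI)
  fix \<epsilon> :: real assume e: "\<epsilon> > 0"
  obtain B where B: "B > 0" "\<And>z. z \<in> S \<Longrightarrow> norm (q z) \<le> B"
    using assms(3) by (auto simp: bounded_pos)
  obtain p where p: "polynomial_fun p" "\<And>z. z \<in> S \<Longrightarrow> norm (h z - p z) \<le> \<epsilon> / B"
    using poly_approximableD[OF assms(1)] e B by (metis divide_pos_pos)
  have "norm (q z * h z - q z * p z) \<le> \<epsilon>" if "z \<in> S" for z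
  proof -
    have "norm (q z) * norm (h z - p z) \<le> B * (\<epsilon> / B)"
      using B p(2) that by (intro mult_mono) auto
    then show ?thesis using B by (simp add: norm_mult[symmetric] right_diff_distrib)
  qed
  then show "\<exists>p. polynomial_fun p \<and> (\<forall>z\<in>S. norm (q z * h z - p z) \<le> \<epsilon>)"
    using polynomial_fun_mult[OF assms(2) p(1)] by blast
qed

lemma poly_approximable_sum:
  assumes "\<And>i. i \<in> I \<Longrightarrow> poly_approximable (h i) S"
  shows "poly_approximable (\<lambda>z. \<Sum>i\<in>I. h i z) S"
  using assms
  by (induction I rule: infinite_finite_induct)
    (auto intro: poly_approximable_add polynomial_fun_imp_approximable polynomial_fun_const)

definition vec_upd :: "'a ^ 'd \<Rightarrow> 'd \<Rightarrow> 'a \<Rightarrow> 'a ^ 'd" where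
  "vec_upd z i t = (\<chi> j. if j = i then t else z $ j)"

lemma vec_upd_nth [simp]: "vec_upd z i t $ j = (if j = i then t else z $ j)"
  by (simp add: vec_upd_def)

lemma vec_upd_same [simp]: "vec_upd z i (z $ i) = z"
  by (simp add: vec_eq_iff)

lemma vec_upd_upd [simp]: "vec_upd (vec_upd z i s) i t = vec_upd z i t"
  by (simp add: vec_eq_iff)

lemma vec_upd_commute: "i \<noteq> j \<Longrightarrow> vec_upd (vec_upd z i s) j t = vec_upd (vec_upd z j t) i s"
  by (simp add: vec_eq_iff)

text \<open>Induction on the set of coordinates on which \<open>h\<close> depends: interpolating in one coordinate
  leaves coefficients that are combinations of slices of \<open>h\<close> in the remaining coordinates.\<close>

lemma poly_approximable_polydisc:
  fixes h :: "'d::finite cvec \<Rightarrow> complex"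
  assumes "0 < \<rho>" "\<rho> < R"
    and sep: "\<And>z i. (\<And>j. norm (z $ j) < R) \<Longrightarrow> (\<lambda>t. h (vec_upd z i t)) holomorphic_on ball 0 R"
    and bnd: "\<And>z. (\<And>j. norm (z $ j) < R) \<Longrightarrow> norm (h z) \<le> 1"
  shows "poly_approximable h {z. \<forall>i. norm (z $ i) \<le> \<rho>}"
proof -
  define D where "D = {z :: 'd cvec. \<forall>j. norm (z $ j) < R}"
  let ?P = "{z :: 'd cvec. \<forall>i. norm (z $ i) \<le> \<rho>}"
  have PD: "?P \<subseteq> D" using assms(2) by (auto simp: D_def intro: le_less_trans)
  have gen: "poly_approximable k ?P"
    if "finite S"
      "\<And>z i. z \<in> D \<Longrightarrow> (\<lambda>t. k (vec_upd z i t)) holomorphic_on ball 0 R"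
      "\<And>z. z \<in> D \<Longrightarrow> norm (k z) \<le> 1"
      "\<And>z z'. z \<in> D \<Longrightarrow> z' \<in> D \<Longrightarrow> (\<And>i. i \<in> S \<Longrightarrow> z $ i = z' $ i) \<Longrightarrow> k z = k z'"
    for S :: "'d set" and k
    using that
  proof (induction S arbitrary: k)
    case empty
    have "0 \<in> D" using assms(1,2) by (simp add: D_def)
    then have "k z = k 0" if "z \<in> ?P" for z
      using empty(3)[of z 0] PD that by auto
    then have "poly_approximable k ?P = poly_approximable (\<lambda>_. k 0) ?P"
      by (rule poly_approximable_cong)
    then show ?case
      by (simp add: polynomial_fun_imp_approximable polynomial_fun_const)
  next
    case (insert i S)
    have updD: "vec_upd z i t \<in> D" if "z \<in> D" "norm t < R" for z t i
      using that by (simp add: D_def)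
    show ?case
    proof (rule poly_approximable_limit)
      fix \<epsilon> :: real assume "\<epsilon> > 0"
      obtain N :: nat and w :: "nat \<Rightarrow> complex" and b where w: "\<And>j. norm (w j) = \<rho>"
        and ip: "\<And>g z. g holomorphic_on ball 0 R \<Longrightarrow> (\<And>z. z \<in> ball 0 R \<Longrightarrow> norm (g z) \<le> 1) \<Longrightarrow>
          norm z \<le> \<rho> \<Longrightarrow> norm (g z - (\<Sum>n<N. \<Sum>j<N. b j n * g (w j) * z ^ n)) \<le> \<epsilon>"
        by (rule circle_interpolation[OF assms(1) order_refl assms(2) \<open>\<epsilon> > 0\<close>]) blast
      define k' where "k' = (\<lambda>z. \<Sum>n<N. \<Sum>j<N. (b j n * z $ i ^ n) * k (vec_upd z i (w j)))"
      \<comment> \<open>Freezing coordinate \<open>i\<close> at a node removes the dependence on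
        \<open>i\<close>, so the induction hypothesis for \<open>S\<close> applies.\<close>
      have slice: "poly_approximable (\<lambda>z. k (vec_upd z i (w j))) ?P" for j
      proof (rule insert.IH)
        fix z i' assume z: "z \<in> D"
        show "(\<lambda>t. k (vec_upd (vec_upd z i' t) i (w j))) holomorphic_on ball 0 R"
        proof (cases "i' = i")
          case False
          then show ?thesis
            using insert.prems(1)[OF updD[OF z, of "w j" i], of i'] w assms(2)
            by (simp add: vec_upd_commute)
        qed simp
      next
        fix z assume "z \<in> D"
        then show "norm (k (vec_upd z i (w j))) \<le> 1"
          using insert.prems(2) updD w assms(2) by simp
      next
        fix z z' assume "z \<in> D" "z' \<in> D" "\<And>i. i \<in> S \<Longrightarrow> z $ i = z' $ i"
        then show "k (vec_upd z i (w j)) = k (vec_upd z' i (w j))"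
          using w assms(2) by (intro insert.prems(3) updD) auto
      qed
      have "bounded ((\<lambda>z. b j n * z $ i ^ n) ` ?P)" for j n
      proof -
        have "norm (b j n * z $ i ^ n) \<le> norm (b j n) * \<rho> ^ n" if "z \<in> ?P" for z
          unfolding norm_mult norm_power using that by (intro mult_left_mono power_mono) auto
        then show ?thesis unfolding bounded_iff by blast
      qed
      then have "poly_approximable k' ?P"
        unfolding k'_def
        by (intro poly_approximable_sum poly_approximable_mult slice polynomial_fun_mult
            polynomial_fun_const polynomial_fun_power polynomial_fun_coord) auto
      moreover have "norm (k z - k' z) \<le> \<epsilon>" if "z \<in> ?P" for z
      proof -
        have "z \<in> D" using that PD by blast
        then show ?thesis
          using ip[of "\<lambda>t. k (vec_upd z i t)" "z $ i"] insert.prems(1,2) updD that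
          by (simp add: k'_def mult_ac)
      qed
      ultimately show "\<exists>h'. poly_approximable h' ?P \<and> (\<forall>z\<in>?P. norm (k z - h' z) \<le> \<epsilon>)"
        by blast
    qed
  qed
  show ?thesis
    by (rule gen[of UNIV]) (use sep bnd in \<open>auto simp: D_def vec_eq_iff intro: arg_cong[of _ _ h]\<close>)
qed

section \<open>Geometry of the image domain\<close>

lemma pos_less_iff: "pos i < pos j \<longleftrightarrow> i < (j :: 'd::{finite,linorder})"
proof -
  have "pos i < pos j" if "i < j" for i j :: 'd
    unfolding pos_def using that by (intro psubset_card_mono) auto
  then show ?thesis by (metis less_asym less_irrefl neqE)
qed

lemma bij_betw_pos: "bij_betw (pos :: 'd::{finite,linorder} \<Rightarrow> nat) UNIV {1..CARD('d)}"
proof -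
  have inj: "inj (pos :: 'd \<Rightarrow> nat)"
    by (rule injI) (metis neqE less_irrefl pos_less_iff)
  have "pos i \<in> {1..CARD('d)}" for i :: 'd
    by (auto simp: pos_def Suc_le_eq card_gt_0_iff intro: card_mono)
  then have "range (pos :: 'd \<Rightarrow> nat) \<subseteq> {1..CARD('d)}" by auto
  moreover have "card (range (pos :: 'd \<Rightarrow> nat)) = card {1..CARD('d)}"
    using inj by (simp add: card_image)
  ultimately have "range (pos :: 'd \<Rightarrow> nat) = {1..CARD('d)}"
    by (intro card_subset_eq) auto
  with inj show ?thesis by (simp add: bij_betw_def)
qed

lemma pos_bounds: "1 \<le> pos i" "pos (i :: 'd::{finite,linorder}) \<le> CARD('d)"
  using bij_betwE[OF bij_betw_pos] by auto

lemma pos_surj: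
  assumes "1 \<le> j" "j \<le> CARD('d::{finite,linorder})"
  obtains i :: "'d::{finite,linorder}" where "pos i = j"
  using bij_betw_imp_surj_on[OF bij_betw_pos[where 'd='d]] assms
  by (metis atLeastAtMost_iff imageE)

text \<open>The index of the coordinate written \<open>q\<^sub>d\<close>, the one in which
  \<open>theta\<close> puts a power of the product of all variables.\<close>

definition last_index :: "'d::{finite,linorder}" where
  "last_index = Max UNIV"

lemma pos_last_index [simp]: "pos (last_index :: 'd::{finite,linorder}) = CARD('d)"
proof -
  have "{..last_index} = (UNIV :: 'd set)" by (auto simp: last_index_def)
  then show ?thesis by (simp add: pos_def)
qed

lemma pos_less_card_iff [simp]: "pos i < CARD('d) \<longleftrightarrow> i \<noteq> (last_index :: 'd::{finite,linorder})"
proof -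
  have "i < last_index \<longleftrightarrow> i \<noteq> last_index"
    by (simp add: last_index_def order_less_le)
  then show ?thesis using pos_less_iff[of i last_index] by simp
qed

lemma theta_nth:
  fixes z :: "'d::{finite,linorder} cvec"
  shows "i \<noteq> last_index \<Longrightarrow> theta m t z $ i = elem_sym (pos i) (\<chi> k. (z $ k) ^ m)"
    and "theta m t z $ last_index = (\<Prod>k\<in>UNIV. z $ k) ^ (m div t)"
  by (simp_all add: theta_def)

text \<open>\<open>dilate\<close> with a complex parameter, so that \<open>f\<close> along a
  dilation orbit becomes a holomorphic function of one variable.\<close>

definition cdilate :: "nat \<Rightarrow> nat \<Rightarrow> complex \<Rightarrow> 'd::{finite,linorder} cvec \<Rightarrow> 'd cvec" where
  "cdilate m t c q =
     (\<chi> i. c ^ (if pos i < CARD('d) then pos i * m else CARD('d) * m div t) * q $ i)"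

lemma dilate_eq_cdilate: "dilate m t r q = cdilate m t (of_real r) q"
  by (simp add: dilate_def cdilate_def)

lemma cdilate_1 [simp]: "cdilate m t 1 q = q"
  by (simp add: cdilate_def)

lemma elem_sym_scale: "elem_sym j (\<chi> i. c * w $ i) = c ^ j * elem_sym j w"
  by (simp add: elem_sym_def sum_distrib_left prod.distrib)

text \<open>Each component of \<open>theta\<close> is homogeneous, and the exponents in
  \<open>cdilate\<close> are the degrees.\<close>

lemma theta_scale:
  fixes z :: "'d::{finite,linorder} cvec"
  assumes "t dvd m"
  shows "theta m t (\<chi> i. c * z $ i) = cdilate m t c (theta m t z)"
proof -
  have "theta m t (\<chi> i. c * z $ i) $ i = cdilate m t c (theta m t z) $ i" for i
  proof (cases "i = last_index")
    case True
    \<comment> \<open>The exponent parses as \<open>(CARD('d) * m) div t\<close>; divisibility turns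
      it into the actual degree of the last component.\<close>
    have "CARD('d) * m div t = CARD('d) * (m div t)"
      using assms by (simp add: div_mult_swap)
    then show ?thesis
      using True by (simp add: theta_nth cdilate_def power_mult_distrib prod.distrib power_mult)
  next
    case False
    then show ?thesis
      using elem_sym_scale[of "pos i" "c ^ m" "\<chi> k. z $ k ^ m"]
      by (simp add: theta_nth cdilate_def power_mult_distrib power_mult[symmetric] mult.commute)
  qed
  then show ?thesis by (simp add: vec_eq_iff)
qed

lemma cdilate_in_theta_dom:
  assumes "t dvd m" "q \<in> theta_dom m t" "norm c \<le> 1"
  shows "cdilate m t c q \<in> theta_dom m t"
proof -
  obtain z where z: "z \<in> polydisc" "q = theta m t z"
    using assms by (auto simp: theta_dom_def)
  have "norm c * norm (z $ i) < 1" for i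
    using z(1) assms(3) mult_left_le_one_le[of "norm (z $ i)" "norm c"]
    by (fastforce simp: polydisc_def intro: le_less_trans)
  then have "(\<chi> i. c * z $ i) \<in> polydisc"
    by (simp add: polydisc_def norm_mult)
  then show ?thesis
    using theta_scale[OF assms(1)] z(2) by (metis imageI theta_dom_def)
qed

lemma cdilate_theta_bdry_in_theta_dom:
  assumes "t dvd m" "q \<in> theta_bdry m t" "norm c < 1"
  shows "cdilate m t c q \<in> theta_dom m t"
proof -
  obtain z where z: "z \<in> torus" "q = theta m t z"
    using assms by (auto simp: theta_bdry_def)
  have "(\<chi> i. c * z $ i) \<in> polydisc"
    using z(1) assms(3) by (simp add: polydisc_def torus_def norm_mult)
  then show ?thesis
    using theta_scale[OF assms(1)] z(2) by (metis imageI theta_dom_def)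
qed

lemma tendsto_dilate_1: "((\<lambda>r. dilate m t r q) \<longlongrightarrow> q) (at_left 1)"
proof -
  have "((\<lambda>r. dilate m t r q $ i) \<longlongrightarrow> q $ i) (at_left 1)" for i
    unfolding dilate_def by (auto intro!: tendsto_eq_intros)
  then show ?thesis by (rule vec_tendstoI)
qed

lemma dilate_theta_bdry_eventually:
  assumes "t dvd m" "q \<in> theta_bdry m t"
  shows "\<forall>\<^sub>F r in at_left 1. dilate m t r q \<in> theta_dom m t"
proof -
  have "\<forall>\<^sub>F r in at_left (1 :: real). r \<in> {0<..<1}"
    by (rule eventually_at_leftI[of 0]) auto
  then show ?thesis
    by eventually_elim (auto simp: dilate_eq_cdilate intro!: cdilate_theta_bdry_in_theta_dom assms)
qed

lemma theta_bdry_subset_closure: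
  assumes "t dvd m"
  shows "theta_bdry m t \<subseteq> closure (theta_dom m t)"
proof
  fix q assume q: "q \<in> theta_bdry m t"
  show "q \<in> closure (theta_dom m t)"
  proof (rule Lim_in_closed_set[OF closed_closure _ _ tendsto_dilate_1])
    show "\<forall>\<^sub>F r in at_left 1. dilate m t r q \<in> closure (theta_dom m t)"
      using dilate_theta_bdry_eventually[OF assms q]
      by (rule eventually_mono) (use closure_subset in blast)
  qed simp
qed

text \<open>A crude bound, since there are at most \<open>2 ^ CARD('d)\<close> subsets and each
  contributes at most 1. Only uniformity in \<open>z\<close> matters later.\<close>

lemma norm_theta_nth_le:
  fixes z :: "'d::{finite,linorder} cvec"
  assumes "\<And>i. norm (z $ i) \<le> 1"
  shows "norm (theta m t z $ i) \<le> 2 ^ CARD('d)"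
proof (cases "i = (last_index :: 'd)")
  case True
  have "norm (theta m t z $ i) \<le> 1 ^ (m div t)"
    unfolding True theta_nth norm_power prod_norm[symmetric]
    by (intro power_mono prod_le_1 prod_nonneg) (use assms in auto)
  also have "\<dots> \<le> 2 ^ CARD('d)" by simp
  finally show ?thesis .
next
  case False
  have "norm (theta m t z $ i) \<le> (\<Sum>S | card S = pos i. norm (\<Prod>k\<in>S. z $ k ^ m))"
    unfolding theta_nth(1)[OF False] elem_sym_def by (intro order_trans[OF norm_sum] sum_mono) simp
  also have "\<dots> \<le> (\<Sum>S\<in>(UNIV :: 'd set set). 1)"
    by (intro sum_mono2 order_trans[OF sum_mono sum_mono2])
      (auto simp: prod_norm[symmetric] norm_power intro!: prod_le_1 power_le_one assms prod_nonneg)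
  also have "\<dots> = 2 ^ CARD('d)"
    using card_Pow[of "UNIV :: 'd set"] by simp
  finally show ?thesis .
qed

text \<open>One factor of the product has modulus below 1 and the others at most 1. This makes the
  powers of \<open>q\<^sub>d\<close> tend to 0 uniformly on compact subsets of the domain.\<close>

lemma norm_theta_last_less_1:
  assumes "m > 0" "t dvd m" "q \<in> theta_dom m t"
  shows "norm (q $ last_index) < 1"
proof -
  obtain z :: "'a cvec" where z: "\<And>i. norm (z $ i) < 1" "q = theta m t z"
    using assms by (auto simp: theta_dom_def polydisc_def)
  have "m div t > 0" using assms by (simp add: dvd_imp_le dvd_pos_nat div_greater_zero_iff)
  have "(\<Prod>k\<in>UNIV. norm (z $ k)) = norm (z $ last_index) * (\<Prod>k\<in>UNIV - {last_index}. norm (z $ k))"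
    by (rule prod.remove) auto
  also have "\<dots> \<le> norm (z $ last_index) * 1"
    by (intro mult_left_mono prod_le_1) (use z in \<open>auto intro: less_imp_le\<close>)
  finally have "(\<Prod>k\<in>UNIV. norm (z $ k)) < 1"
    using z(1)[of last_index] by simp
  moreover have "0 \<le> (\<Prod>k\<in>UNIV. norm (z $ k))" by (simp add: prod_nonneg)
  ultimately show ?thesis
    using \<open>m div t > 0\<close> by (simp add: z(2) theta_nth norm_power prod_norm[symmetric] power_less_one_iff)
qed

text \<open>Vieta's formula: expand the product over subsets and group them by cardinality.\<close>

lemma prod_diff_eq_elem_sym:
  fixes w :: "'d::finite cvec"
  shows "(\<Prod>i\<in>UNIV. x - w $ i) = (\<Sum>j\<le>CARD('d). (-1) ^ j * elem_sym j w * x ^ (CARD('d) - j))"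
proof -
  have "(\<Prod>i\<in>UNIV. x - w $ i) = (\<Prod>i\<in>UNIV. - w $ i + x)" by simp
  also have "\<dots> = (\<Sum>X\<in>UNIV. (\<Prod>i\<in>X. - w $ i) * (\<Prod>i\<in>UNIV - X. x))"
    by (subst prod_add) auto
  also have "\<dots> = (\<Sum>X\<in>UNIV. (-1) ^ card X * (\<Prod>i\<in>X. w $ i) * x ^ (CARD('d) - card X))"
    by (intro sum.cong) (auto simp: prod_uminus card_Diff_subset)
  also have "\<dots> = (\<Sum>j\<le>CARD('d). \<Sum>X | X \<in> UNIV \<and> card X = j.
      (-1) ^ card X * (\<Prod>i\<in>X. w $ i) * x ^ (CARD('d) - card X))"
    by (intro sum.group[symmetric]) (auto intro: card_mono)
  also have "\<dots> = (\<Sum>j\<le>CARD('d). (-1) ^ j * elem_sym j w * x ^ (CARD('d) - j))"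
    unfolding elem_sym_def sum_distrib_left sum_distrib_right by (intro sum.cong) auto
  finally show ?thesis .
qed

text \<open>Over the complex numbers the monic polynomial with coefficients
  \<open>(-1) ^ j * c j\<close> splits. Its roots, distributed over the indices by
  \<open>pos\<close>, form \<open>w\<close>, and comparing coefficients in Vieta's formula gives the
  claim.\<close>

lemma ex_elem_sym_eq:
  fixes c :: "nat \<Rightarrow> complex"
  obtains w :: "'d::{finite,linorder} cvec"
  where "\<And>j. 1 \<le> j \<Longrightarrow> j \<le> CARD('d) \<Longrightarrow> elem_sym j w = c j"
proof -
  let ?d = "CARD('d)"
  \<comment> \<open>The value at 0 is overridden by 1 to make \<open>p\<close> monic.\<close>
  define c' where "c' = (\<lambda>j. (-1) ^ j * (if j = 0 then 1 else c j))"
  define p where "p = (\<Sum>j\<le>?d. monom (c' j) (?d - j))"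
  have coeff_sum: "coeff (\<Sum>j\<le>?d. monom (e j) (?d - j)) (?d - k) = e k" if "k \<le> ?d"
    for e :: "nat \<Rightarrow> complex" and k
  proof -
    have "coeff (\<Sum>j\<le>?d. monom (e j) (?d - j)) (?d - k) = (\<Sum>j\<le>?d. if j = k then e k else 0)"
      unfolding coeff_sum using that by (intro sum.cong) auto
    then show ?thesis using that by simp
  qed
  have "coeff p ?d = 1" using coeff_sum[of 0 c'] by (simp add: p_def c'_def)
  moreover have "degree p \<le> ?d"
    unfolding p_def by (intro degree_sum_le) (auto intro: order_trans[OF degree_monom_le])
  ultimately have deg: "degree p = ?d" and lead: "lead_coeff p = 1"
    using le_degree[of p ?d] by (auto intro: antisym)
  then have "p \<noteq> 0" by auto
  obtain A where A: "size A = ?d" "p = (\<Prod>x\<in>#A. [:- x, 1:])"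
    using alg_closed_imp_factorization[OF \<open>p \<noteq> 0\<close>] deg lead by auto
  obtain xs where xs: "mset xs = A" using ex_mset by blast
  define w :: "'d cvec" where "w = (\<chi> i. xs ! (pos i - 1))"
  have len: "length xs = ?d" using A xs by auto
  have "poly p x = (\<Prod>i\<in>UNIV. x - w $ i)" for x
  proof -
    have "poly p x = prod_list (map (\<lambda>y. x - y) xs)"
      unfolding A(2) xs[symmetric] by (induction xs) (simp_all add: algebra_simps)
    also have "\<dots> = (\<Prod>k<?d. x - xs ! k)"
      using len by (simp add: prod.list_conv_set_nth atLeast0LessThan)
    also have "\<dots> = (\<Prod>j\<in>{1..?d}. x - xs ! (j - 1))"
      by (rule prod.reindex_bij_witness[of _ "\<lambda>j. j - 1" Suc]) auto
    also have "\<dots> = (\<Prod>i\<in>UNIV. x - w $ i)"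
      by (subst prod.reindex_bij_betw[OF bij_betw_pos[where 'd='d], symmetric]) (simp add: w_def)
    finally show ?thesis .
  qed
  then have "poly p = poly (\<Sum>j\<le>?d. monom ((-1) ^ j * elem_sym j w) (?d - j))"
    by (simp add: fun_eq_iff prod_diff_eq_elem_sym poly_sum poly_monom)
  then have "p = (\<Sum>j\<le>?d. monom ((-1) ^ j * elem_sym j w) (?d - j))"
    by (simp add: poly_eq_poly_eq_iff)
  then have c': "c' j = (-1) ^ j * elem_sym j w" if "j \<le> ?d" for j
    using coeff_sum[OF that, of c'] coeff_sum[OF that, of "\<lambda>j. (-1) ^ j * elem_sym j w"]
    by (simp add: p_def)
  have "elem_sym j w = c j" if "1 \<le> j" "j \<le> ?d" for j
    using c'[OF that(2)] that(1) by (simp add: c'_def)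
  then show ?thesis by (rule that)
qed

text \<open>If a root \<open>x\<close> had modulus at least 1, then \<open>x ^ d\<close> would be,
  up to sign, a sum of \<open>d\<close> terms, each of modulus below
  \<open>norm x ^ d / d\<close>.\<close>

lemma norm_less_1_if_small_elem_sym:
  fixes w :: "'d::finite cvec"
  assumes "\<And>j. 1 \<le> j \<Longrightarrow> j \<le> CARD('d) \<Longrightarrow> norm (elem_sym j w) < 1 / CARD('d)"
  shows "norm (w $ i) < 1"
proof (rule ccontr)
  assume "\<not> ?thesis"
  then have x: "norm (w $ i) \<ge> 1" by simp
  let ?d = "CARD('d)" and ?x = "w $ i"
  have "(\<Prod>k\<in>UNIV. ?x - w $ k) = 0" by (intro prod_zero) auto
  then have "0 = (\<Sum>j\<le>?d. (-1) ^ j * elem_sym j w * ?x ^ (?d - j))"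
    by (simp add: prod_diff_eq_elem_sym)
  also have "\<dots> = (\<Sum>j\<in>insert 0 {1..?d}. (-1) ^ j * elem_sym j w * ?x ^ (?d - j))"
    by (intro sum.cong) auto
  also have "\<dots> = ?x ^ ?d + (\<Sum>j\<in>{1..?d}. (-1) ^ j * elem_sym j w * ?x ^ (?d - j))"
  proof -
    have "{S :: 'd set. card S = 0} = {{}}" by auto
    then show ?thesis by (simp add: elem_sym_def)
  qed
  finally have "norm (?x ^ ?d) = norm (\<Sum>j\<in>{1..?d}. (-1) ^ j * elem_sym j w * ?x ^ (?d - j))"
    by (metis add.inverse_unique norm_minus_cancel)
  also have "\<dots> \<le> (\<Sum>j\<in>{1..?d}. norm (elem_sym j w) * norm ?x ^ (?d - j))"
    by (rule order_trans[OF norm_sum]) (simp add: norm_mult norm_power)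
  also have "\<dots> < (\<Sum>j\<in>{1..?d}. 1 / ?d * norm ?x ^ ?d)"
  proof (rule sum_strict_mono)
    fix j assume j: "j \<in> {1..?d}"
    have "norm (elem_sym j w) * norm ?x ^ (?d - j) \<le> norm (elem_sym j w) * norm ?x ^ ?d"
      using x by (intro mult_left_mono power_increasing) auto
    also have "\<dots> < 1 / ?d * norm ?x ^ ?d"
      using assms[of j] j x by (intro mult_strict_right_mono) (auto intro: zero_less_power less_le_trans[OF zero_less_one])
    finally show "norm (elem_sym j w) * norm ?x ^ (?d - j) < 1 / ?d * norm ?x ^ ?d" .
  qed auto
  also have "\<dots> = norm (?x ^ ?d)" by (simp add: norm_power)
  finally show False by simp
qed

lemma elem_sym_card: "elem_sym CARD('d) (w :: 'd::finite cvec) = (\<Prod>i\<in>UNIV. w $ i)"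
proof -
  have "{S :: 'd set. card S = CARD('d)} = {UNIV}"
    using card_subset_eq[of "UNIV :: 'd set"] by auto
  then show ?thesis by (simp add: elem_sym_def)
qed

text \<open>The first \<open>d - 1\<close> coordinates and the \<open>t\<close>-th power of the last one prescribe the polynomial
  with roots \<open>z\<^sub>i ^ m\<close>; rotating one \<open>z\<^sub>i\<close> by an \<open>m\<close>-th root of unity then adjusts the last
  coordinate itself.\<close>

lemma small_polydisc_subset_theta_dom:
  assumes "m > 0" "t > 0" "t dvd m"
  shows "{q :: 'd::{finite,linorder} cvec. \<forall>i. norm (q $ i) < 1 / CARD('d)} \<subseteq> theta_dom m t"
proof
  fix q :: "'d cvec" assume "q \<in> {q. \<forall>i. norm (q $ i) < 1 / CARD('d)}"
  then have q: "norm (q $ i) < 1 / CARD('d)" for i by simp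
  let ?d = "CARD('d)" and ?l = "last_index :: 'd" and ?k = "m div t"
  have k: "?k > 0" using assms by (simp add: dvd_imp_le div_greater_zero_iff)
  have mk: "m = ?k * t" using assms by simp
  define c where "c = (\<lambda>j. if j = ?d then (q $ ?l) ^ t else q $ (inv_into UNIV pos j))"
  obtain w :: "'d cvec" where w: "\<And>j. 1 \<le> j \<Longrightarrow> j \<le> ?d \<Longrightarrow> elem_sym j w = c j"
    using ex_elem_sym_eq[of c] by metis
  have "norm (c j) < 1 / ?d" for j
  proof -
    have "norm (q $ ?l) \<le> 1" using q[of ?l] by (rule order_trans[OF less_imp_le]) simp
    then have "norm (q $ ?l) ^ t \<le> norm (q $ ?l) ^ 1"
      using assms by (intro power_decreasing) auto
    then show ?thesis using q le_less_trans[OF _ q[of ?l]] by (auto simp: c_def norm_power)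
  qed
  then have w1: "norm (w $ i) < 1" for i
    using w by (intro norm_less_1_if_small_elem_sym) simp
  have "\<exists>y. y ^ m = w $ i" for i
    using nth_root_exists[OF assms(1)] by metis
  then obtain y where y: "\<And>i. y i ^ m = w $ i" by metis
  define u where "u = (\<Prod>i\<in>UNIV. y i)"
  have "u ^ m = (\<Prod>i\<in>UNIV. w $ i)"
    by (simp add: u_def prod_power_distrib y)
  also have "\<dots> = elem_sym ?d w" by (rule elem_sym_card[symmetric])
  also have "\<dots> = (q $ ?l) ^ t" using w[of ?d] by (simp add: c_def Suc_le_eq)
  finally have ukt: "(u ^ ?k) ^ t = (q $ ?l) ^ t"
    by (metis mk power_mult)
  \<comment> \<open>\<open>u ^ ?k\<close> and the last coordinate of \<open>q\<close> have the same
    \<open>t\<close>-th power. If \<open>u ^ ?k\<close> is nonzero, their quotient is a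
    \<open>t\<close>-th root of unity, and any \<open>?k\<close>-th root of it is an
    \<open>m\<close>-th root of unity because \<open>m = ?k * t\<close>. If it is zero, both vanish
    and 1 serves.\<close>
  obtain \<eta> where \<eta>: "\<eta> ^ m = 1" "\<eta> ^ ?k * u ^ ?k = q $ ?l"
  proof (cases "u ^ ?k = 0")
    case True
    then have "q $ ?l = 0" using ukt assms by (simp add: power_0_left)
    then show ?thesis using True by (intro that[of 1]) auto
  next
    case False
    obtain \<eta> where \<eta>: "\<eta> ^ ?k = q $ ?l / u ^ ?k"
      using nth_root_exists[OF k] by metis
    have "(q $ ?l) ^ t \<noteq> 0" using False ukt by (metis power_not_zero)
    then have "\<eta> ^ m = 1"
      using ukt \<eta> by (subst mk) (simp add: power_mult power_divide)
    then show ?thesis using False \<eta> by (intro that[of \<eta>]) auto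
  qed
  define z :: "'d cvec" where "z = (\<chi> i. if i = ?l then \<eta> * y i else y i)"
  have zm: "z $ i ^ m = w $ i" for i
    by (simp add: z_def power_mult_distrib \<eta> y)
  have "norm (z $ i) < 1" for i
  proof -
    have "norm (z $ i) ^ m < 1" using w1[of i] by (simp add: zm[symmetric] norm_power)
    then show ?thesis using assms(1) by (simp add: power_less_one_iff)
  qed
  then have "z \<in> polydisc" by (simp add: polydisc_def)
  moreover have "theta m t z = q"
  proof -
    have "theta m t z $ i = q $ i" for i
    proof (cases "i = ?l")
      case True
      have "(\<Prod>i\<in>UNIV. z $ i) = \<eta> * u"
        by (simp add: z_def u_def prod.remove[of UNIV ?l])
      then show ?thesis using True \<eta>(2) by (simp add: theta_nth power_mult_distrib)
    next
      case False
      have "(\<chi> k. z $ k ^ m) = w" by (simp add: zm)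
      moreover have "elem_sym (pos i) w = q $ i"
      proof -
        have "pos i \<noteq> ?d" using False pos_less_card_iff[of i] by linarith
        then show ?thesis
          using w[OF pos_bounds[of i]] bij_betw_imp_inj_on[OF bij_betw_pos[where 'd='d]]
          by (simp add: c_def)
      qed
      ultimately show ?thesis using False by (simp add: theta_nth)
    qed
    then show ?thesis by (simp add: vec_eq_iff)
  qed
  ultimately show "q \<in> theta_dom m t" by (auto simp: theta_dom_def)
qed

section \<open>Polynomial approximation on the image domain\<close>

definition holomorphic_at_vec :: "('d::finite cvec \<Rightarrow> complex) \<Rightarrow> 'd cvec \<Rightarrow> bool" where
  "holomorphic_at_vec f z \<longleftrightarrow> (\<exists>D. (f has_derivative D) (at z) \<and> (\<forall>c v. D (c *s v) = c * D v))"

lemma holomorphic_on_vec_iff: "holomorphic_on_vec f S \<longleftrightarrow> (\<forall>z\<in>S. holomorphic_at_vec f z)"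
  by (simp add: holomorphic_on_vec_def holomorphic_at_vec_def)

lemma holomorphic_at_vec_const: "holomorphic_at_vec (\<lambda>_. k) z"
  unfolding holomorphic_at_vec_def by (rule exI[of _ "\<lambda>_. 0"]) simp

lemma holomorphic_at_vec_coord: "holomorphic_at_vec (\<lambda>z. z $ i) z"
  unfolding holomorphic_at_vec_def
  by (rule exI[of _ "\<lambda>v. v $ i"])
    (simp add: bounded_linear_imp_has_derivative bounded_linear_vec_nth)

lemma holomorphic_at_vec_add:
  assumes "holomorphic_at_vec f z" "holomorphic_at_vec g z"
  shows "holomorphic_at_vec (\<lambda>z. f z + g z) z"
proof -
  obtain D E where "(f has_derivative D) (at z)" "\<And>c v. D (c *s v) = c * D v"
    "(g has_derivative E) (at z)" "\<And>c v. E (c *s v) = c * E v"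
    using assms by (auto simp: holomorphic_at_vec_def)
  then show ?thesis
    unfolding holomorphic_at_vec_def
    by (intro exI[of _ "\<lambda>v. D v + E v"] conjI has_derivative_add) (simp_all add: distrib_left)
qed

lemma holomorphic_at_vec_mult:
  assumes "holomorphic_at_vec f z" "holomorphic_at_vec g z"
  shows "holomorphic_at_vec (\<lambda>z. f z * g z) z"
proof -
  obtain D E where "(f has_derivative D) (at z)" "\<And>c v. D (c *s v) = c * D v"
    "(g has_derivative E) (at z)" "\<And>c v. E (c *s v) = c * E v"
    using assms by (auto simp: holomorphic_at_vec_def)
  then show ?thesis
    unfolding holomorphic_at_vec_def
    by (intro exI[of _ "\<lambda>v. f z * E v + D v * g z"] conjI has_derivative_mult)
      (simp_all add: algebra_simps)
qed

lemma holomorphic_at_vec_divide: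
  assumes "holomorphic_at_vec f z" "holomorphic_at_vec g z" "g z \<noteq> 0"
  shows "holomorphic_at_vec (\<lambda>z. f z / g z) z"
proof -
  obtain D E where "(f has_derivative D) (at z)" "\<And>c v. D (c *s v) = c * D v"
    "(g has_derivative E) (at z)" "\<And>c v. E (c *s v) = c * E v"
    using assms by (auto simp: holomorphic_at_vec_def)
  then show ?thesis
    unfolding holomorphic_at_vec_def using assms(3)
    by (intro exI[of _ "\<lambda>v. - f z * (inverse (g z) * E v * inverse (g z)) + D v / g z"]
        conjI has_derivative_divide) (simp_all add: algebra_simps)
qed

lemma holomorphic_at_vec_polynomial_fun: "polynomial_fun p \<Longrightarrow> holomorphic_at_vec p z"
  by (induction rule: polynomial_fun_induct)
    (auto intro: holomorphic_at_vec_const holomorphic_at_vec_coord holomorphic_at_vec_add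
      holomorphic_at_vec_mult)

lemma continuous_on_holomorphic_on_vec:
  "holomorphic_on_vec f S \<Longrightarrow> continuous_on S f"
  unfolding holomorphic_on_vec_def
  by (meson continuous_at_imp_continuous_on has_derivative_continuous)

lemma bounded_linear_vector_scalar_mult_left:
  "bounded_linear (\<lambda>c :: complex. c *s (v :: 'd::finite cvec))"
  unfolding linear_conv_bounded_linear[symmetric]
  by (rule linearI) (simp_all add: vec_eq_iff algebra_simps)

text \<open>The chain rule gives the real derivative \<open>\<lambda>h. D (h *s v)\<close>, and
  complex linearity of \<open>D\<close> turns it into multiplication by \<open>D v\<close>. Through
  this, one-variable theory applies to \<open>f\<close>.\<close>

lemma holomorphic_on_vec_compose_curve:
  assumes f: "holomorphic_on_vec f S" and "open T"
    and u: "\<And>i. (\<lambda>t. u t $ i) holomorphic_on T" and uS: "\<And>t. t \<in> T \<Longrightarrow> u t \<in> S"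
  shows "(\<lambda>t. f (u t)) holomorphic_on T"
  unfolding holomorphic_on_open[OF \<open>open T\<close>]
proof
  fix t assume t: "t \<in> T"
  obtain u' where u': "\<And>i. ((\<lambda>t. u t $ i) has_field_derivative u' i) (at t)"
  proof -
    have "\<exists>d. ((\<lambda>t. u t $ i) has_field_derivative d) (at t)" for i
      using u[of i] t holomorphic_on_open[OF \<open>open T\<close>] by blast
    then show ?thesis using that by metis
  qed
  define v where "v = (\<chi> i. u' i)"
  obtain D where D: "(f has_derivative D) (at (u t))" "\<And>c v. D (c *s v) = c * D v"
    using f uS[OF t] by (auto simp: holomorphic_on_vec_def)
  \<comment> \<open>Derivatives are known coordinatewise only, so the curve is expanded in the
    standard basis.\<close>
  have "((\<lambda>t. \<Sum>i\<in>UNIV. (u t $ i) *s axis i 1) has_derivative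
      (\<lambda>h. \<Sum>i\<in>UNIV. (u' i * h) *s axis i 1)) (at t)"
    using u' unfolding has_field_derivative_def
    by (intro has_derivative_sum bounded_linear.has_derivative[OF bounded_linear_vector_scalar_mult_left])
  moreover have "(\<Sum>i\<in>UNIV. (u' i * h) *s axis i 1) = h *s v" for h
    using basis_expansion[of "h *s v"] by (simp add: v_def mult.commute)
  ultimately have "(u has_derivative (\<lambda>h. h *s v)) (at t)"
    by (simp add: basis_expansion)
  then have "((\<lambda>t. f (u t)) has_derivative (\<lambda>h. D (h *s v))) (at t)"
    using D(1) by (rule has_derivative_compose)
  then have "((\<lambda>t. f (u t)) has_field_derivative D v) (at t)"
    by (simp add: has_field_derivative_def D(2) mult_commute_abs)
  then show "\<exists>f'. ((\<lambda>t. f (u t)) has_field_derivative f') (at t)" by blast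
qed

text \<open>Interpolation in the dilation parameter at nodes so small that the dilated points lie in a
  polydisc inside the domain, where polynomial approximation is available.\<close>

lemma poly_approximable_dilate:
  fixes f :: "'d::{finite,linorder} cvec \<Rightarrow> complex"
  assumes mt: "m > 0" "t > 0" "t dvd m"
    and f: "holomorphic_on_vec f (theta_dom m t)" "f ` theta_dom m t \<subseteq> cball 0 1"
    and r: "0 < r" "r < 1"
  shows "poly_approximable (\<lambda>q. f (dilate m t r q)) (theta_dom m t)"
proof (rule poly_approximable_limit)
  fix \<epsilon> :: real assume "\<epsilon> > 0"
  let ?d = "CARD('d)"
  define R where "R = 1 / real ?d"
  have R: "R > 0" by (simp add: R_def)
  define wt where "wt = (\<lambda>i :: 'd. if pos i < ?d then pos i * m else ?d * m div t)"
  have cd: "cdilate m t c q = (\<chi> i. c ^ wt i * q $ i)" for c and q :: "'d cvec"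
    by (simp add: cdilate_def wt_def)
  have wt: "wt i \<ge> 1" for i
  proof -
    have "m div t > 0" using mt by (simp add: dvd_imp_le div_greater_zero_iff)
    then have "?d * m div t > 0" using mt by (simp add: div_mult_swap[symmetric])
    then show ?thesis using mt pos_bounds[of i] by (simp add: wt_def Suc_le_eq)
  qed
  have fb: "norm (f q) \<le> 1" if "q \<in> theta_dom m t" for q
    using f(2) that by auto
  have small: "q \<in> theta_dom m t" if "\<And>i. norm (q $ i) < R" for q :: "'d cvec"
    using small_polydisc_subset_theta_dom[OF mt] that by (auto simp: R_def)
  have f_small: "poly_approximable f {q. \<forall>i. norm (q $ i) \<le> R / 2}"
  proof (rule poly_approximable_polydisc[of "R / 2" R])
    fix z :: "'d cvec" and i assume z: "\<And>j. norm (z $ j) < R"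
    show "(\<lambda>s. f (vec_upd z i s)) holomorphic_on ball 0 R"
    proof (rule holomorphic_on_vec_compose_curve[OF f(1)])
      show "(\<lambda>s. vec_upd z i s $ j) holomorphic_on ball 0 R" for j
        by (cases "j = i") (auto intro: holomorphic_intros)
      show "vec_upd z i s \<in> theta_dom m t" if "s \<in> ball 0 R" for s
        by (rule small) (use z that in auto)
    qed simp
  qed (use R fb small in auto)
  \<comment> \<open>Coordinates on the domain are at most \<open>2 ^ ?d\<close>, and as all weights
    are at least 1, dilation by a node shrinks them by at least \<open>\<rho>\<close>. The second
    term of the minimum thus brings them below \<open>R / 2\<close>; the first is required for
    interpolation.\<close>
  define \<rho> where "\<rho> = min r (R / 2 / 2 ^ ?d)"
  have \<rho>: "0 < \<rho>" "\<rho> \<le> r" "\<rho> \<le> 1" using R r by (auto simp: \<rho>_def)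
  have \<rho>2: "\<rho> * 2 ^ ?d \<le> R / 2"
  proof -
    have "\<rho> \<le> R / 2 / 2 ^ ?d" by (simp add: \<rho>_def)
    then show ?thesis by (simp add: pos_le_divide_eq)
  qed
  obtain N :: nat and w :: "nat \<Rightarrow> complex" and b where w: "\<And>j. norm (w j) = \<rho>"
    and ip: "\<And>g z. g holomorphic_on ball 0 1 \<Longrightarrow> (\<And>z. z \<in> ball 0 1 \<Longrightarrow> norm (g z) \<le> 1) \<Longrightarrow>
      norm z \<le> r \<Longrightarrow> norm (g z - (\<Sum>n<N. \<Sum>j<N. b j n * g (w j) * z ^ n)) \<le> \<epsilon>"
    by (rule circle_interpolation[OF \<rho>(1,2) r(2) \<open>\<epsilon> > 0\<close>]) blast
  define h where "h = (\<lambda>q :: 'd cvec. \<Sum>n<N. \<Sum>j<N.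
    (b j n * of_real r ^ n) * f (cdilate m t (w j) q))"
  have "poly_approximable (\<lambda>q. f (cdilate m t (w j) q)) (theta_dom m t)" for j
    unfolding poly_approximable_def
  proof (intro allI impI)
    fix e :: real assume "e > 0"
    then obtain p where p: "polynomial_fun p"
      "\<And>q. q \<in> {q. \<forall>i. norm (q $ i) \<le> R / 2} \<Longrightarrow> norm (f q - p q) \<le> e"
      by (rule poly_approximableD[OF f_small]) blast
    have "norm (f (cdilate m t (w j) q) - p (cdilate m t (w j) q)) \<le> e"
      if q: "q \<in> theta_dom m t" for q
    proof (rule p(2))
      obtain z where z: "z \<in> polydisc" "q = theta m t z" using q by (auto simp: theta_dom_def)
      have "norm (cdilate m t (w j) q $ i) \<le> R / 2" for i
      proof -
        have "norm (cdilate m t (w j) q $ i) = \<rho> ^ wt i * norm (q $ i)"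
          by (simp add: cd norm_mult norm_power w)
        also have "\<dots> \<le> \<rho> ^ 1 * 2 ^ ?d"
          using \<rho> wt[of i] z
          by (intro mult_mono power_decreasing) (auto simp: polydisc_def less_imp_le intro!: norm_theta_nth_le)
        also have "\<dots> \<le> R / 2" using \<rho>2 by simp
        finally show ?thesis .
      qed
      then show "cdilate m t (w j) q \<in> {q. \<forall>i. norm (q $ i) \<le> R / 2}" by simp
    qed
    moreover have "polynomial_fun (\<lambda>q. p (cdilate m t (w j) q))"
      unfolding cd by (rule polynomial_fun_scale[OF p(1)])
    ultimately show "\<exists>p. polynomial_fun p \<and>
        (\<forall>z\<in>theta_dom m t. norm (f (cdilate m t (w j) z) - p z) \<le> e)"
      by (intro exI[of _ "\<lambda>q. p (cdilate m t (w j) q)"]) auto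
  qed
  then have "poly_approximable h (theta_dom m t)"
    unfolding h_def
    by (intro poly_approximable_sum poly_approximable_mult polynomial_fun_const)
      (auto simp: image_constant_conv)
  moreover have "norm (f (dilate m t r q) - h q) \<le> \<epsilon>" if q: "q \<in> theta_dom m t" for q
  proof -
    have dom: "cdilate m t c q \<in> theta_dom m t" if "c \<in> ball 0 1" for c
      using cdilate_in_theta_dom[OF mt(3) q] that by simp
    \<comment> \<open>For every \<open>q\<close> this function meets the hypotheses of the
      interpolation estimate, so the same nodes and weights serve all \<open>q\<close> with the same
      error.\<close>
    have "(\<lambda>c. f (cdilate m t c q)) holomorphic_on ball 0 1"
    proof (rule holomorphic_on_vec_compose_curve[OF f(1)])
      show "(\<lambda>c. cdilate m t c q $ i) holomorphic_on ball 0 1" for i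
        unfolding cd vec_lambda_beta by (intro holomorphic_intros)
    qed (use dom in auto)
    from ip[OF this fb[OF dom], of "of_real r"] show ?thesis
      using r by (simp add: h_def dilate_eq_cdilate mult_ac)
  qed
  ultimately show "\<exists>h. poly_approximable h (theta_dom m t) \<and>
      (\<forall>q\<in>theta_dom m t. norm (f (dilate m t r q) - h q) \<le> \<epsilon>)" by blast
qed

section \<open>Boundary values of polynomials\<close>

text \<open>On the torus conjugation is inversion, so the product over \<open>- S\<close> is the
  full product times the conjugate of the product over \<open>S\<close>. Complementation matches
  subsets of size \<open>j\<close> with those of size \<open>CARD('d) - j\<close>.\<close>

lemma elem_sym_reflect:
  fixes w :: "'d::finite cvec"
  assumes "\<And>i. norm (w $ i) = 1" "j \<le> CARD('d)"
  shows "elem_sym (CARD('d) - j) w = (\<Prod>i\<in>UNIV. w $ i) * cnj (elem_sym j w)"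
proof -
  have "(\<Prod>i\<in>- S. w $ i) = (\<Prod>i\<in>UNIV. w $ i) * cnj (\<Prod>i\<in>S. w $ i)" for S
  proof -
    have "w $ i * cnj (w $ i) = 1" for i
      using assms(1)[of i] by (simp add: complex_norm_square[symmetric])
    then have "(\<Prod>i\<in>S. w $ i) * cnj (\<Prod>i\<in>S. w $ i) = 1"
      by (simp add: prod.distrib[symmetric])
    moreover have "(\<Prod>i\<in>UNIV. w $ i) = (\<Prod>i\<in>- S. w $ i) * (\<Prod>i\<in>S. w $ i)"
      using prod.union_disjoint[of "- S" S "\<lambda>i. w $ i"] by simp
    ultimately show ?thesis by (metis mult.assoc mult.right_neutral)
  qed
  moreover have "card (- S) = CARD('d) - card S" for S :: "'d set"
    by (simp add: Compl_eq_Diff_UNIV card_Diff_subset)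
  then have "elem_sym (CARD('d) - j) w = (\<Sum>S | card S = j. \<Prod>i\<in>- S. w $ i)"
    unfolding elem_sym_def
    by (intro sum.reindex_bij_witness[of _ uminus uminus]) (use assms(2) in auto)
  ultimately show ?thesis by (simp add: elem_sym_def sum_distrib_left)
qed

lemma norm_theta_bdry_last:
  assumes "q \<in> theta_bdry m t"
  shows "norm (q $ last_index) = 1"
proof -
  obtain z where "z \<in> torus" "q = theta m t z" using assms by (auto simp: theta_bdry_def)
  then show ?thesis by (simp add: theta_nth norm_power prod_norm[symmetric] torus_def)
qed

text \<open>On the image of the torus \<open>q\<^sub>d ^ t * cnj q\<^sub>j = q\<^sub>d\<^sub>-\<^sub>j\<close>, since complementary elementary symmetric
  polynomials are conjugate up to the product of the variables.\<close>

lemma polynomial_conj_on_bdry: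
  fixes p :: "'d::{finite,linorder} cvec \<Rightarrow> complex"
  assumes "t dvd m" "polynomial_fun p"
  shows "\<exists>a Q. polynomial_fun Q \<and> (\<forall>q\<in>theta_bdry m t. Q q = (q $ last_index) ^ a * cnj (p q))"
  using assms(2)
proof (induction rule: polynomial_fun_induct)
  case (const k)
  show ?case by (rule exI[of _ 0]) (auto intro: polynomial_fun_const)
next
  case (coord i)
  show ?case
  proof (cases "i = last_index")
    case True
    have "1 = q $ last_index ^ 1 * cnj (q $ i)" if "q \<in> theta_bdry m t" for q
      using norm_theta_bdry_last[OF that] True by (simp add: complex_norm_square[symmetric])
    then show ?thesis using polynomial_fun_const[of 1] by blast
  next
    case False
    then have "pos i < CARD('d)" by simp
    then obtain j :: 'd where j: "pos j = CARD('d) - pos i"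
      using pos_surj[of "CARD('d) - pos i"] by (metis Suc_leI diff_le_self One_nat_def zero_less_diff)
    moreover have "j \<noteq> last_index" using j pos_bounds[of i] pos_bounds[of j] by auto
    moreover have "q $ j = q $ last_index ^ t * cnj (q $ i)" if q: "q \<in> theta_bdry m t" for q
    proof -
      obtain z where z: "z \<in> torus" "q = theta m t z" using q by (auto simp: theta_bdry_def)
      have "q $ last_index ^ t = (\<Prod>k\<in>UNIV. z $ k ^ m)"
        using assms(1) by (simp add: z(2) theta_nth power_mult[symmetric] prod_power_distrib)
      then show ?thesis
        using elem_sym_reflect[of "\<chi> k. z $ k ^ m" "pos i"] z(1) False \<open>j \<noteq> last_index\<close> j
          pos_bounds(2)[of i]
        by (simp add: z(2) theta_nth torus_def norm_power)
    qed
    ultimately show ?thesis using polynomial_fun_coord[of j] by blast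
  qed
next
  case (add p1 p2)
  then obtain a1 Q1 a2 Q2 where Q: "polynomial_fun Q1" "polynomial_fun Q2"
    "\<And>q. q \<in> theta_bdry m t \<Longrightarrow> Q1 q = q $ last_index ^ a1 * cnj (p1 q)"
    "\<And>q. q \<in> theta_bdry m t \<Longrightarrow> Q2 q = q $ last_index ^ a2 * cnj (p2 q)"
    by blast
  \<comment> \<open>The two exponents may differ; the cross factors bring both to
    \<open>a1 + a2\<close>.\<close>
  have "polynomial_fun (\<lambda>q. q $ last_index ^ a2 * Q1 q + q $ last_index ^ a1 * Q2 q)"
    by (intro polynomial_fun_add polynomial_fun_mult polynomial_fun_power polynomial_fun_coord Q)
  moreover have "q $ last_index ^ a2 * Q1 q + q $ last_index ^ a1 * Q2 q =
      q $ last_index ^ (a1 + a2) * cnj (p1 q + p2 q)" if "q \<in> theta_bdry m t" for q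
    using Q(3,4)[OF that] by (simp add: power_add algebra_simps)
  ultimately show ?case by blast
next
  case (mult p1 p2)
  then obtain a1 Q1 a2 Q2 where Q: "polynomial_fun Q1" "polynomial_fun Q2"
    "\<And>q. q \<in> theta_bdry m t \<Longrightarrow> Q1 q = q $ last_index ^ a1 * cnj (p1 q)"
    "\<And>q. q \<in> theta_bdry m t \<Longrightarrow> Q2 q = q $ last_index ^ a2 * cnj (p2 q)"
    by blast
  have "Q1 q * Q2 q = q $ last_index ^ (a1 + a2) * cnj (p1 q * p2 q)"
    if "q \<in> theta_bdry m t" for q
    using Q(3,4)[OF that] by (simp add: power_add)
  then show ?case using polynomial_fun_mult[OF Q(1,2)] by blast
qed

text \<open>The one-variable maximum principle moves one coordinate at a time from the closed disc
  to the circle. The induction runs over the set of coordinates that may still lie off the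
  circle.\<close>

lemma maximum_modulus_torus:
  fixes h :: "'d::finite cvec \<Rightarrow> complex"
  assumes hol: "\<And>z i. (\<lambda>s. h (vec_upd z i s)) holomorphic_on UNIV"
    and bnd: "\<And>z. z \<in> torus \<Longrightarrow> norm (h z) \<le> c"
    and z: "\<And>i. norm (z $ i) \<le> 1"
  shows "norm (h z) \<le> c"
proof -
  have "norm (h z) \<le> c"
    if "finite S" "\<And>i. i \<in> S \<Longrightarrow> norm (z $ i) \<le> 1" "\<And>i. i \<notin> S \<Longrightarrow> norm (z $ i) = 1" for S z
    using that
  proof (induction S arbitrary: z)
    case empty
    then show ?case by (intro bnd) (simp add: torus_def)
  next
    case (insert i S)
    have "norm (h (vec_upd z i (z $ i))) \<le> c"
    proof (rule maximum_modulus_frontier[of "\<lambda>s. h (vec_upd z i s)" "cball 0 1"])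
      show "(\<lambda>s. h (vec_upd z i s)) holomorphic_on interior (cball 0 1)"
        using hol by (rule holomorphic_on_subset) simp
      show "continuous_on (closure (cball 0 1)) (\<lambda>s. h (vec_upd z i s))"
        using holomorphic_on_imp_continuous_on[OF hol] by (rule continuous_on_subset) simp
      show "norm (h (vec_upd z i s)) \<le> c" if "s \<in> frontier (cball 0 1)" for s
        by (rule insert.IH) (use insert that in auto)
    qed (use insert.prems in auto)
    then show ?case by simp
  qed
  from this[of UNIV z] show ?thesis using z by simp
qed

lemma polynomial_bound_closure_theta_dom:
  fixes p :: "'d::{finite,linorder} cvec \<Rightarrow> complex"
  assumes "polynomial_fun p" "\<And>q. q \<in> theta_dom m t \<Longrightarrow> norm (p q) \<le> c"
    and "q \<in> closure (theta_dom m t)"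
  shows "norm (p q) \<le> c"
  using continuous_on_closure_norm_le[OF continuous_on_polynomial_fun[OF assms(1)] _ assms(3)]
    assms(2) by blast

text \<open>Pulled back by \<open>theta\<close>, the polynomial is entire in each variable, so the
  maximum principle on the polydisc transfers to the image domain.\<close>

lemma polynomial_bound_bdry_imp_dom:
  fixes p :: "'d::{finite,linorder} cvec \<Rightarrow> complex"
  assumes p: "polynomial_fun p" "\<And>q. q \<in> theta_bdry m t \<Longrightarrow> norm (p q) \<le> c"
    and q: "q \<in> theta_dom m t"
  shows "norm (p q) \<le> c"
proof -
  obtain z where z: "z \<in> polydisc" "q = theta m t z" using q by (auto simp: theta_dom_def)
  have "norm (p (theta m t z)) \<le> c"
  proof (rule maximum_modulus_torus[where h = "\<lambda>z. p (theta m t z)"])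
    fix z :: "'d cvec" and i
    have upd: "(\<lambda>s. vec_upd z i s $ k) holomorphic_on UNIV" for k
      by (cases "k = i") (auto intro: holomorphic_intros)
    show "(\<lambda>s. p (theta m t (vec_upd z i s))) holomorphic_on UNIV"
    proof (rule holomorphic_on_polynomial_fun[OF p(1)])
      show "(\<lambda>s. theta m t (vec_upd z i s) $ j) holomorphic_on UNIV" for j
        by (cases "j = last_index")
          (simp_all only: theta_nth elem_sym_def vec_lambda_beta not_False_eq_True,
            (intro holomorphic_intros upd)+)
    qed
  next
    show "norm (p (theta m t z)) \<le> c" if "z \<in> torus" for z
      using that by (intro p(2)) (simp add: theta_bdry_def)
    show "norm (z $ i) \<le> 1" for i using z(1) by (simp add: polydisc_def less_imp_le)
  qed
  then show ?thesis by (simp add: z(2))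
qed

section \<open>Rational inner functions\<close>

text \<open>Continuity up to the boundary makes the dilation limit exist at every point of
  \<open>theta_bdry\<close>, with value \<open>g q\<close>; no exceptional null set arises.\<close>

lemma rational_innerI:
  fixes g :: "'d::{finite,linorder} cvec \<Rightarrow> complex"
  assumes "t dvd m" and "rational_on g (theta_dom m t)" and "g \<in> A_algebra m t"
    and "bounded (g ` theta_dom m t)" and unit: "\<And>q. q \<in> theta_bdry m t \<Longrightarrow> norm (g q) = 1"
  shows "rational_inner m t g"
proof -
  have "((\<lambda>r. g (dilate m t r q)) \<longlongrightarrow> bdry_fun m t g q) (at_left 1) \<and> norm (bdry_fun m t g q) = 1"
    if "q \<in> space (bdry_measure m t)" for q
  proof -
    have q: "q \<in> theta_bdry m t"
      using that by (simp add: bdry_measure_def space_restrict_space)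
    have "((\<lambda>r. g (dilate m t r q)) \<longlongrightarrow> g q) (at_left 1)"
    proof (rule continuous_on_tendsto_compose[OF _ tendsto_dilate_1])
      show "continuous_on (closure (theta_dom m t)) g"
        using assms(3) by (simp add: A_algebra_def)
      show "q \<in> closure (theta_dom m t)"
        using theta_bdry_subset_closure[OF assms(1)] q by blast
      show "\<forall>\<^sub>F r in at_left 1. dilate m t r q \<in> closure (theta_dom m t)"
        using dilate_theta_bdry_eventually[OF assms(1) q]
        by (rule eventually_mono) (use closure_subset in blast)
    qed
    moreover from this have "bdry_fun m t g q = g q"
      unfolding bdry_fun_def by (intro tendsto_Lim) auto
    ultimately show ?thesis using unit[OF q] by simp
  qed
  then show ?thesis
    using assms by (auto simp: rational_inner_def is_inner_def H_infty_def A_algebra_def intro: AE_I2)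
qed

text \<open>With \<open>M\<close> a power of \<open>q\<^sub>d\<close>, the function \<open>(M + p) / (1 + M cnj p)\<close> is unimodular wherever
  \<open>\<bar>M\<bar> = 1\<close>, and \<open>M cnj p\<close> agrees with a polynomial on the image of the torus.\<close>

lemma rational_inner_near_polynomial:
  fixes p :: "'d::{finite,linorder} cvec \<Rightarrow> complex"
  assumes mt: "m > 0" "t > 0" "t dvd m"
    and p: "polynomial_fun p" "\<And>q. q \<in> theta_dom m t \<Longrightarrow> norm (p q) \<le> c" "0 \<le> c" "c < 1" and "n > 0"
  obtains g where "rational_inner m t g" "g \<in> A_algebra m t"
    "\<And>q. q \<in> theta_dom m t \<Longrightarrow>
      norm (g q - p q) \<le> 2 * norm (q $ last_index) ^ n / (1 - norm (q $ last_index) ^ n)"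
proof -
  let ?D = "theta_dom m t :: 'd cvec set"
  obtain a Q where Q: "polynomial_fun Q"
    "\<And>q. q \<in> theta_bdry m t \<Longrightarrow> Q q = (q $ last_index) ^ a * cnj (p q)"
    using polynomial_conj_on_bdry[OF mt(3) p(1)] by blast
  have p_cl: "norm (p q) \<le> c" if "q \<in> closure ?D" for q
    using polynomial_bound_closure_theta_dom[OF p(1,2) that] by simp
  \<comment> \<open>On the image of the torus \<open>Q\<close> and \<open>p\<close> have equal
    modulus. The bound passes to the domain by the maximum principle and to the closure by
    continuity, which keeps the denominator \<open>B\<close> below away from 0 there.\<close>
  have "norm (Q q) \<le> c" if "q \<in> theta_bdry m t" for q
    using Q(2)[OF that] norm_theta_bdry_last[OF that] p_cl theta_bdry_subset_closure[OF mt(3)] that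
    by (auto simp: norm_mult norm_power)
  then have "norm (Q q) \<le> c" if "q \<in> ?D" for q
    using polynomial_bound_bdry_imp_dom[OF Q(1) _ that] by blast
  then have Q_cl: "norm (Q q) \<le> c" if "q \<in> closure ?D" for q
    using polynomial_bound_closure_theta_dom[OF Q(1) _ that] by blast
  have l_dom: "norm (q $ last_index) < 1" if "q \<in> ?D" for q
    using norm_theta_last_less_1[OF mt(1,3) that] .
  have l_cl: "norm (q $ last_index) \<le> 1" if "q \<in> closure ?D" for q
    using polynomial_bound_closure_theta_dom[OF polynomial_fun_coord _ that] l_dom less_imp_le
    by metis
  define A where "A = (\<lambda>q :: 'd cvec. q $ last_index ^ (a + n) + p q)"
  define B where "B = (\<lambda>q :: 'd cvec. 1 + q $ last_index ^ n * Q q)"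
  define g where "g = (\<lambda>q. A q / B q)"
  have AB: "polynomial_fun A" "polynomial_fun B"
    unfolding A_def B_def
    by (intro polynomial_fun_add polynomial_fun_mult polynomial_fun_power polynomial_fun_coord
        polynomial_fun_const Q p)+
  have B_cl: "norm (B q) \<ge> 1 - c" if "q \<in> closure ?D" for q
  proof -
    have "norm (q $ last_index ^ n * Q q) \<le> 1 * c"
      unfolding norm_mult norm_power
      by (intro mult_mono power_le_one) (use l_cl[OF that] Q_cl[OF that] in auto)
    then show ?thesis
      using norm_diff_ineq[of 1 "q $ last_index ^ n * Q q"] by (simp add: B_def)
  qed
  then have B0: "B q \<noteq> 0" if "q \<in> closure ?D" for q
    using that p(4) by fastforce
  note D_cl = closure_subset[of ?D, THEN subsetD]
  have g_A: "g \<in> A_algebra m t"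
    unfolding A_algebra_def holomorphic_on_vec_iff g_def mem_Collect_eq
    by (intro conjI ballI continuous_on_divide continuous_on_polynomial_fun holomorphic_at_vec_divide
        holomorphic_at_vec_polynomial_fun AB) (use B0 D_cl in blast)+
  have g_bdd: "norm (g q) \<le> 2 / (1 - c)" if "q \<in> ?D" for q
  proof -
    have "norm (A q) \<le> norm (q $ last_index) ^ (a + n) + norm (p q)"
      unfolding A_def by (rule order_trans[OF norm_triangle_ineq]) (simp add: norm_power)
    also have "\<dots> \<le> 1 + 1"
      by (intro add_mono power_le_one) (use l_dom[OF that] p(2)[OF that] p(4) in auto)
    finally show ?thesis
      unfolding g_def norm_divide using B_cl[OF D_cl[OF that]] p(4) by (intro frac_le) auto
  qed
  have "norm (g q) = 1" if "q \<in> theta_bdry m t" for q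
  proof -
    define M where "M = q $ last_index ^ (a + n)"
    have "norm M = 1" using norm_theta_bdry_last[OF that] by (simp add: M_def norm_power)
    then have M: "M * cnj M = 1" by (simp add: complex_norm_square[symmetric])
    have "B q = 1 + M * cnj (p q)"
      using Q(2)[OF that] by (simp add: B_def M_def power_add mult_ac)
    \<comment> \<open>As \<open>M * cnj M = 1\<close>, the numerator is \<open>M\<close> times the
      conjugate of the denominator; hence equal moduli.\<close>
    moreover have "A q = M * cnj (1 + M * cnj (p q))"
      using M by (simp add: A_def M_def[symmetric] distrib_left mult.assoc[symmetric])
    ultimately have "norm (A q) = norm (B q)"
      using \<open>norm M = 1\<close> by (metis complex_mod_cnj mult_1 norm_mult)
    moreover have "B q \<noteq> 0"
      using B0 theta_bdry_subset_closure[OF mt(3)] that by blast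
    ultimately show ?thesis by (simp add: g_def norm_divide)
  qed
  moreover have "rational_on g ?D"
    unfolding rational_on_def using AB B0 D_cl by (intro exI[of _ A] exI[of _ B]) (auto simp: g_def)
  moreover have "bounded (g ` ?D)"
    unfolding bounded_iff using g_bdd by blast
  ultimately have "rational_inner m t g"
    using mt(3) g_A by (intro rational_innerI)
  moreover have "norm (g q - p q) \<le> 2 * norm (q $ last_index) ^ n / (1 - norm (q $ last_index) ^ n)"
    if q: "q \<in> ?D" for q
  proof -
    define x where "x = norm (q $ last_index) ^ n"
    have x: "0 \<le> x" "x < 1"
      using l_dom[OF q] \<open>n > 0\<close> by (auto simp: x_def power_less_one_iff)
    define E where "E = q $ last_index ^ n * Q q"
    have E: "norm E \<le> x"
      unfolding E_def norm_mult norm_power x_def[symmetric]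
      using Q_cl[OF D_cl[OF q]] p(4) x by (intro mult_left_le) auto
    have "norm (q $ last_index ^ (a + n)) \<le> x"
      unfolding norm_power x_def using l_dom[OF q] by (intro power_decreasing) auto
    moreover have "norm (p q * E) \<le> x"
      unfolding norm_mult using p(2)[OF q] p(4) E x
      by (intro order_trans[OF mult_left_le_one_le]) auto
    ultimately have "norm (q $ last_index ^ (a + n) - p q * E) \<le> 2 * x"
      using norm_triangle_ineq4[of "q $ last_index ^ (a + n)" "p q * E"] by linarith
    moreover have "norm (1 + E) \<ge> 1 - x"
      using norm_diff_ineq[of 1 E] E by simp
    \<comment> \<open>Clearing denominators cancels \<open>p\<close>, and both remaining terms carry
      the small factor \<open>q $ last_index ^ n\<close>.\<close>
    moreover have "g q - p q = (q $ last_index ^ (a + n) - p q * E) / (1 + E)"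
      using B0[OF D_cl[OF q]] by (simp add: g_def A_def B_def E_def field_simps)
    ultimately show ?thesis
      unfolding x_def[symmetric] using x by (simp only: norm_divide) (intro frac_le; simp)
  qed
  ultimately show ?thesis using g_A that by blast
qed

section \<open>From polynomials to the given function\<close>

lemma rational_inner_near_dilate:
  fixes f :: "'d::{finite,linorder} cvec \<Rightarrow> complex"
  assumes mt: "m > 0" "t > 0" "t dvd m"
    and f: "holomorphic_on_vec f (theta_dom m t)" "f ` theta_dom m t \<subseteq> cball 0 1"
    and r: "0 < r" "r < 1" and "\<epsilon> > 0" "n > 0"
  shows "\<exists>g. rational_inner m t g \<and> g \<in> A_algebra m t \<and>
    (\<forall>q\<in>theta_dom m t. norm (g q - f (dilate m t r q)) \<le>
      3 * \<epsilon> + 2 * norm (q $ last_index) ^ n / (1 - norm (q $ last_index) ^ n))"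
proof -
  let ?D = "theta_dom m t :: 'd cvec set"
  obtain p where p: "polynomial_fun p"
    "\<And>q. q \<in> ?D \<Longrightarrow> norm (f (dilate m t r q) - p q) \<le> \<epsilon>"
    using poly_approximableD[OF poly_approximable_dilate[OF mt f r] \<open>\<epsilon> > 0\<close>] by metis
  have p1: "norm (p q) \<le> 1 + \<epsilon>" if "q \<in> ?D" for q
  proof -
    have "dilate m t r q \<in> ?D"
      using cdilate_in_theta_dom[OF mt(3) that] r by (simp add: dilate_eq_cdilate)
    then have "norm (f (dilate m t r q)) \<le> 1" using f(2) by auto
    then show ?thesis
      using p(2)[OF that] norm_triangle_ineq2[of "p q" "f (dilate m t r q)"]
      by (simp add: norm_minus_commute)
  qed
  \<comment> \<open>The modulus of \<open>p\<close> may reach \<open>1 + \<epsilon>\<close>.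
    Dividing by \<open>1 + 2 * \<epsilon>\<close> gives a bound strictly below 1 and moves
    \<open>p\<close> by at most \<open>2 * \<epsilon>\<close>, hence the
    \<open>3 * \<epsilon>\<close> in the estimate.\<close>
  define p' where "p' = (\<lambda>q. of_real (1 / (1 + 2 * \<epsilon>)) * p q)"
  have np': "norm (p' q) = norm (p q) / (1 + 2 * \<epsilon>)" for q
    using \<open>\<epsilon> > 0\<close> by (simp add: p'_def norm_mult norm_divide del: of_real_add of_real_mult)
  have "polynomial_fun p'"
    unfolding p'_def by (intro polynomial_fun_mult polynomial_fun_const p)
  moreover have "norm (p' q) \<le> (1 + \<epsilon>) / (1 + 2 * \<epsilon>)" if "q \<in> ?D" for q
    using p1[OF that] \<open>\<epsilon> > 0\<close> by (simp add: np' divide_right_mono)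
  moreover have "0 \<le> (1 + \<epsilon>) / (1 + 2 * \<epsilon>)" "(1 + \<epsilon>) / (1 + 2 * \<epsilon>) < 1"
    using \<open>\<epsilon> > 0\<close> by auto
  ultimately obtain g where g: "rational_inner m t g" "g \<in> A_algebra m t"
    "\<And>q. q \<in> ?D \<Longrightarrow>
      norm (g q - p' q) \<le> 2 * norm (q $ last_index) ^ n / (1 - norm (q $ last_index) ^ n)"
    using rational_inner_near_polynomial[OF mt _ _ _ _ \<open>n > 0\<close>] by metis
  have "norm (g q - f (dilate m t r q)) \<le>
      3 * \<epsilon> + 2 * norm (q $ last_index) ^ n / (1 - norm (q $ last_index) ^ n)" if q: "q \<in> ?D" for q
  proof -
    have "p q - p' q = of_real (2 * \<epsilon>) * p' q"
    proof -
      have "p q = of_real (1 + 2 * \<epsilon>) * p' q"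
        using \<open>\<epsilon> > 0\<close> by (simp add: p'_def mult.assoc[symmetric] of_real_mult[symmetric]
            del: of_real_mult of_real_add)
      then show ?thesis by (simp add: algebra_simps)
    qed
    then have "norm (p q - p' q) = 2 * \<epsilon> * norm (p' q)"
      using \<open>\<epsilon> > 0\<close> by (simp add: norm_mult)
    moreover have "norm (p' q) \<le> 1"
      using p1[OF q] \<open>\<epsilon> > 0\<close> by (simp add: np')
    ultimately have "norm (p q - p' q) \<le> 2 * \<epsilon>"
      using \<open>\<epsilon> > 0\<close> by (simp add: mult_left_le)
    moreover have "norm (g q - f (dilate m t r q)) \<le>
        norm (g q - p' q) + norm (p q - p' q) + norm (f (dilate m t r q) - p q)"
      using norm_triangle_ineq4[of "(g q - p' q) - (p q - p' q)" "f (dilate m t r q) - p q"]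
        norm_triangle_ineq4[of "g q - p' q" "p q - p' q"] by simp
    ultimately show ?thesis using g(3)[OF q] p(2)[OF q] by linarith
  qed
  then show ?thesis using g(1,2) by blast
qed

text \<open>The map taking \<open>(r, q)\<close> to \<open>f (dilate m t r q)\<close> is uniformly
  continuous on the compact set \<open>{0..1} \<times> K\<close>, and at \<open>r = 1\<close> it is
  \<open>f\<close>.\<close>

lemma uniform_limit_dilate:
  fixes f :: "'d::{finite,linorder} cvec \<Rightarrow> complex"
  assumes "t dvd m" "continuous_on (theta_dom m t) f" "compact K" "K \<subseteq> theta_dom m t"
    and r: "\<And>k. r k \<in> {0..1}" "r \<longlonglongrightarrow> 1"
  shows "uniform_limit K (\<lambda>k q. f (dilate m t (r k) q)) f sequentially"
proof (rule uniform_limitI)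
  fix e :: real assume "e > 0"
  have "continuous_on ({0..1} \<times> K) (\<lambda>x. f (dilate m t (fst x) (snd x)))"
  proof (rule continuous_on_compose2[OF assms(2)])
    show "continuous_on ({0..1} \<times> K) (\<lambda>x. dilate m t (fst x) (snd x))"
      unfolding dilate_def
      by (intro continuous_intros)
    show "(\<lambda>x. dilate m t (fst x) (snd x)) ` ({0..1} \<times> K) \<subseteq> theta_dom m t"
      using assms(4) by (auto simp: dilate_eq_cdilate intro!: cdilate_in_theta_dom[OF assms(1)])
  qed
  then have "uniformly_continuous_on ({0..1} \<times> K) (\<lambda>x. f (dilate m t (fst x) (snd x)))"
    using assms(3) by (intro compact_uniformly_continuous compact_Times) auto
  then obtain d where d: "d > 0" "\<And>x x'. x \<in> {0..1} \<times> K \<Longrightarrow> x' \<in> {0..1} \<times> K \<Longrightarrow> dist x' x < d \<Longrightarrow>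
      dist (f (dilate m t (fst x') (snd x'))) (f (dilate m t (fst x) (snd x))) < e"
    using \<open>e > 0\<close> unfolding uniformly_continuous_on_def by metis
  have "\<forall>\<^sub>F k in sequentially. dist (r k) 1 < d"
    using r(2) d(1) by (rule tendstoD)
  then show "\<forall>\<^sub>F k in sequentially. \<forall>q\<in>K. dist (f (dilate m t (r k) q)) (f q) < e"
  proof eventually_elim
    case (elim k)
    show ?case
    proof
      fix q assume "q \<in> K"
      then show "dist (f (dilate m t (r k) q)) (f q) < e"
        using d(2)[of "(1, q)" "(r k, q)"] r(1)[of k] elim
        by (simp add: dist_Pair_Pair dilate_eq_cdilate)
    qed
  qed
qed

theorem theoremB:
  fixes m t :: nat and f :: "'d::{finite,linorder} cvec \<Rightarrow> complex"
  assumes "CARD('d) > 1" and "m > 0" and "t > 0" and "t dvd m"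
    and "holomorphic_on_vec f (theta_dom m t)"
    and "f ` theta_dom m t \<subseteq> cball 0 1"
  shows "\<exists>g :: nat \<Rightarrow> 'd cvec \<Rightarrow> complex.
           (\<forall>k. rational_inner m t (g k) \<and> g k \<in> A_algebra m t) \<and>
           (\<forall>K. compact K \<and> K \<subseteq> theta_dom m t \<longrightarrow> uniform_limit K g f sequentially)"
proof -
  \<comment> \<open>The shift by 2 keeps the radius positive at \<open>k = 0\<close>.\<close>
  define r where "r = (\<lambda>k. 1 - 1 / (real k + 2))"
  have r: "0 < r k" "r k < 1" for k by (auto simp: r_def field_simps)
  \<comment> \<open>Radius, polynomial error \<open>1 / Suc k\<close> and power \<open>Suc k\<close>
    are tied to the single index \<open>k\<close>, so one sequence works for every compact
    \<open>K\<close>.\<close>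
  have "\<exists>g. rational_inner m t g \<and> g \<in> A_algebra m t \<and>
    (\<forall>q\<in>theta_dom m t. norm (g q - f (dilate m t (r k) q)) \<le> 3 * (1 / real (Suc k)) +
      2 * norm (q $ last_index) ^ Suc k / (1 - norm (q $ last_index) ^ Suc k))" for k
    by (rule rational_inner_near_dilate[OF assms(2-6) r]) auto
  then obtain g where g: "\<And>k. rational_inner m t (g k)" "\<And>k. g k \<in> A_algebra m t"
    "\<And>k q. q \<in> theta_dom m t \<Longrightarrow> norm (g k q - f (dilate m t (r k) q)) \<le> 3 * (1 / real (Suc k)) +
      2 * norm (q $ last_index) ^ Suc k / (1 - norm (q $ last_index) ^ Suc k)"
    by metis
  have "uniform_limit K g f sequentially" if K: "compact K" "K \<subseteq> theta_dom m t" for K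
  proof (rule uniform_limitI)
    fix e :: real assume "e > 0"
    \<comment> \<open>\<open>\<kappa>\<close> is the maximum of the modulus of the last coordinate
      on \<open>K\<close>; the empty set, where no maximum exists, is treated apart. The error term
      increases with that modulus, so its value at \<open>\<kappa>\<close> bounds it on
      \<open>K\<close>.\<close>
    obtain \<kappa> where \<kappa>: "0 \<le> \<kappa>" "\<kappa> < 1" "\<And>q. q \<in> K \<Longrightarrow> norm (q $ last_index) \<le> \<kappa>"
    proof (cases "K = {}")
      case True
      then show ?thesis by (intro that[of 0]) auto
    next
      case False
      have "continuous_on K (\<lambda>q. norm (q $ last_index))" by (intro continuous_intros)
      then obtain q0 where "q0 \<in> K" "\<And>q. q \<in> K \<Longrightarrow> norm (q $ last_index) \<le> norm (q0 $ last_index)"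
        using continuous_attains_sup[OF K(1) False] by blast
      then show ?thesis
        using norm_theta_last_less_1[OF assms(2,4)] K(2) by (intro that[of "norm (q0 $ last_index)"]) auto
    qed
    have "(\<lambda>k. 3 * (1 / real (Suc k)) + 2 * \<kappa> ^ Suc k / (1 - \<kappa> ^ Suc k)) \<longlonglongrightarrow>
        3 * 0 + 2 * 0 / (1 - 0)"
      using \<kappa> by (intro tendsto_intros LIMSEQ_Suc[OF LIMSEQ_power_zero]
          LIMSEQ_Suc[OF lim_1_over_n]) auto
    then have "\<forall>\<^sub>F k in sequentially. 3 * (1 / real (Suc k)) + 2 * \<kappa> ^ Suc k / (1 - \<kappa> ^ Suc k) < e / 2"
      using \<open>e > 0\<close> by (intro order_tendstoD) auto
    moreover have "uniform_limit K (\<lambda>k q. f (dilate m t (r k) q)) f sequentially"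
    proof (rule uniform_limit_dilate[OF assms(4) _ K])
      show "continuous_on (theta_dom m t) f"
        using assms(5) by (rule continuous_on_holomorphic_on_vec)
      have "(\<lambda>k. 1 - 1 / (real (k + 2))) \<longlonglongrightarrow> 1 - 0"
        by (intro tendsto_intros LIMSEQ_ignore_initial_segment[OF lim_1_over_n])
      then show "r \<longlonglongrightarrow> 1" by (simp add: r_def add.commute)
    qed (use r less_imp_le in auto)
    then have "\<forall>\<^sub>F k in sequentially. \<forall>q\<in>K. dist (f (dilate m t (r k) q)) (f q) < e / 2"
      using \<open>e > 0\<close> by (intro uniform_limitD) auto
    ultimately show "\<forall>\<^sub>F k in sequentially. \<forall>q\<in>K. dist (g k q) (f q) < e"
    proof eventually_elim
      case (elim k)
      show ?case
      proof
        fix q assume q: "q \<in> K"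
        have "norm (q $ last_index) ^ Suc k \<le> \<kappa> ^ Suc k"
          using \<kappa>(3)[OF q] by (intro power_mono) auto
        moreover have "\<kappa> ^ Suc k < 1"
          using \<kappa> by (subst power_less_one_iff) auto
        ultimately have "2 * norm (q $ last_index) ^ Suc k / (1 - norm (q $ last_index) ^ Suc k)
            \<le> 2 * \<kappa> ^ Suc k / (1 - \<kappa> ^ Suc k)"
          using \<kappa>(1) by (intro frac_le) auto
        then have "dist (g k q) (f (dilate m t (r k) q)) < e / 2"
          using g(3)[of q k] q K(2) elim(1) by (force simp: dist_norm)
        moreover have "dist (f (dilate m t (r k) q)) (f q) < e / 2"
          using elim(2) q by blast
        ultimately show "dist (g k q) (f q) < e"
          using dist_triangle[of "g k q" "f q" "f (dilate m t (r k) q)"] by linarith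
      qed
    qed
  qed
  then show ?thesis using g(1,2) by blast
qed

end
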